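(* Let $q\ge1$, let $a_1,\dots,a_q>0$ and $b_1,\dots,b_q>0$, and suppose $\mu:=\prod_{i=1}^q a_i/b_i\in(0,1)$. Assume that either (i) $b_k>a_k>0$ for every $k=1,\dots,q$ (the case of a nonnegative Euler density), or (ii) the Meijer $G$-function density $\rho_{\mathbf a,\mathbf b}(s)=G^{q,0}_{q,q}\left(s\,\middle|\,\begin{matrix}\mathbf b\\ \mathbf a\end{matrix}\right)$ is nonnegative on $(0,1)$. Then for every $\sigma>0$ and every nonzero real $x>-1$, $$(1+x\mu)^{-\sigma}<{}_{q+1}F_q(\sigma,a_1,\dots,a_q;b_1,\dots,b_q;-x)<(1-\mu)+\mu\,(1+x)^{-\sigma}.$$
   Context: ${}_{q+1}F_q(\sigma,a_1,\dots,a_q;b_1,\dots,b_q;y)$ is the generalised hypergeometric function, given for $|y|<1$ by $\sum_{n\ge0}\frac{(\sigma)_n\prod_i(a_i)_n}{\prod_i(b_i)_n}\frac{y^n}{n!}$, where $(c)_n=c(c+1)\cdots(c+n-1)$, and by analytic continuation to $\mathbb C\setminus[1,\infty)$; it is evaluated here at $y=-x<1$. When $b_k>a_k>0$ for all $k$, this function has a generalised Stieltjes representation, as the integral over $s\in(0,1)$ of $(1+sx)^{-\sigma}$ against a nonnegative density (the Euler density). For $0<s<1$, with $\mathbf a=(a_1,\dots,a_q)$ and $\mathbf b=(b_1,\dots,b_q)$, $$G^{q,0}_{q,q}\left(s\,\middle|\,\begin{matrix}\mathbf b\\ \mathbf a\end{matrix}\right)=\frac1{2\pi i}\int_{\mathcal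 L}\frac{\prod_{i=1}^q\Gamma(a_i+z)}{\prod_{i=1}^q\Gamma(b_i+z)}\,s^{-z}\,dz,$$ where $\mathcal L$ is a loop starting and ending at $-\infty$ and encircling all poles of $\prod_i\Gamma(a_i+z)$ once in the positive direction.
   Formalization: Case (ii) additionally assumes a_1+…+a_q ≤ b_1+…+b_q; without it the claim fails, e.g. q=2, a=(9,0.3), b=(2,2), σ=1, x=-1/2, where G is positive on (0,1) but the upper bound is violated. *)

theory Defs
  imports "HOL-Complex_Analysis.Complex_Analysis"
begin

text \<open>Parameter vectors are functions \<open>nat \<Rightarrow> real\<close> of which only the entries with index in
  \<open>{1..q}\<close> matter.\<close>

definition hyp_series :: "nat \<Rightarrow> real \<Rightarrow> (nat \<Rightarrow> real) \<Rightarrow> (nat \<Rightarrow> real) \<Rightarrow> complex \<Rightarrow> complex" where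
  "hyp_series q \<sigma> a b y =
     (\<Sum>n. complex_of_real (pochhammer \<sigma> n * (\<Prod>i=1..q. pochhammer (a i) n)
                              / (\<Prod>i=1..q. pochhammer (b i) n))
            * y ^ n / fact n)"

text \<open>The slit plane is connected, so the continuation of the series is unique on it and the choice
  below is immaterial there; off the slit plane the value is unspecified.\<close>

definition hyp_F :: "nat \<Rightarrow> real \<Rightarrow> (nat \<Rightarrow> real) \<Rightarrow> (nat \<Rightarrow> real) \<Rightarrow> complex \<Rightarrow> complex" where
  "hyp_F q \<sigma> a b =
     (SOME F. F holomorphic_on (UNIV - complex_of_real ` {1..}) \<and>
              (\<forall>y. norm y < 1 \<longrightarrow> F y = hyp_series q \<sigma> a b y))"

text \<open>The loop comes in along the line \<open>Im z = -1\<close>, goes up along the imaginary axis and returns along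
  \<open>Im z = 1\<close>; it is truncated at \<open>Re z = -R\<close>. For \<open>a i > 0\<close> the poles of the integrand,
  \<open>- a i - n\<close>, all lie on the negative real axis, hence inside the loop. Any other admissible
  loop gives the same integral by Cauchy's theorem.\<close>

definition left_loop :: "real \<Rightarrow> real \<Rightarrow> complex" where
  "left_loop R = linepath (Complex (- R) (- 1)) (Complex 0 (- 1)) +++
                 linepath (Complex 0 (- 1)) (Complex 0 1) +++
                 linepath (Complex 0 1) (Complex (- R) 1)"

text \<open>For \<open>0 < s < 1\<close> the limit exists and is real (the integrand is conjugation symmetric).
  The value at \<open>s\<close> is defined without any condition on the parameters, but
  \<open>meijer_G q a b\<close> is the density of the Stieltjes measure of \<open>hyp_F\<close> (up to the factor \<open>1/s\<close> and
  normalisation) only if \<open>\<Sum> a i < \<Sum> b i\<close>; when the two sums are equal the measure has an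
  additional atom at \<open>s = 1\<close>, and when \<open>\<Sum> a i > \<Sum> b i\<close> the function no longer determines a
  representing measure. For \<open>a = (9, 3/10)\<close>, \<open>b = (2, 2)\<close>, for instance, it is positive on \<open>(0, 1)\<close> but
  not integrable at \<open>1\<close>.\<close>

definition meijer_G :: "nat \<Rightarrow> (nat \<Rightarrow> real) \<Rightarrow> (nat \<Rightarrow> real) \<Rightarrow> real \<Rightarrow> complex" where
  "meijer_G q a b s =
     1 / (2 * of_real pi * \<i>) *
     Lim at_top (\<lambda>R. contour_integral (left_loop R)
       (\<lambda>z. (\<Prod>i=1..q. Gamma (of_real (a i) + z)) / (\<Prod>i=1..q. Gamma (of_real (b i) + z))
            * of_real s powr (- z)))"

end

theory Submission
  imports Defs "HOL-Real_Asymp.Real_Asymp"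
begin

text \<open>
  Write \<open>m n\<close> for the product of the quotients \<open>(a i)\<^sub>n / (b i)\<^sub>n\<close>. In both cases \<open>m\<close> is the moment sequence of
  a probability measure on \<open>[0, 1]\<close> with mean \<open>\<mu>\<close>, and the hypergeometric function at \<open>- x\<close> is the
  integral of the convex function \<open>s \<mapsto> (1 + x * s) powr (- \<sigma>)\<close> against it. Jensen's inequality bounds that
  integral from below by the value at the mean, and the chord over \<open>[0, 1]\<close> bounds it from above. Both
  bounds are strict unless the measure is a point mass, respectively lives on \<open>{0, 1}\<close>. A point mass at
  \<open>\<mu> < 1\<close> is impossible because \<open>m (n + 1) / m n\<close> tends to 1; a measure on \<open>{0, 1}\<close> would make the
  polynomials \<open>\<Prod>i. a i + X\<close> and \<open>\<Prod>i. b i + X\<close> agree at all positive integers, hence at 0, against \<open>\<mu> < 1\<close>.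

  The measure itself is replaced by complete monotonicity of \<open>m\<close>, that is, nonnegativity of all its
  backward differences. These differences are the weights that the measure would give to the Bernstein
  polynomials, so they define discrete approximations with nodes \<open>k / N\<close>. The corresponding Bernstein sums
  of \<open>(1 - s * y) powr (- \<sigma>)\<close> converge to the series on the unit disc and form a normal family on the slit
  plane, so that Montel's theorem yields the analytic continuation as their limit
  (\<open>hyp_F_eq_lim_bernstein_sum\<close>). The two inequalities hold for every Bernstein sum, with a margin
  proportional to the variance, respectively to \<open>m 1 - m 2\<close>, and the margin survives the limit
  (\<open>hyp_F_bounds\<close>).

  When \<open>b k > a k\<close> for all \<open>k\<close>, complete monotonicity is read off a closed formula for one factor and the
  Leibniz rule for differences. When the Meijer density \<open>G\<close> is nonnegative, let \<open>\<phi>\<close> be the quotient of Gamma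
  products in its integrand. Formally, integrating \<open>G s\<close> against \<open>s powr (t - 1) * (1 - s) ^ K\<close> and exchanging
  the integrals turns the loop integral into one of \<open>\<phi> z * Beta (t - z) (K + 1)\<close>, whose residues to the right
  of the loop add up to the \<open>K\<close>-th backward difference of \<open>\<phi>\<close> at \<open>t\<close>; hence that difference is nonnegative
  (\<open>Re_difference_nonneg\<close>). The factor \<open>(1 - s) ^ K\<close> makes everything converge once \<open>K\<close> exceeds the growth
  exponent of \<open>\<phi>\<close>, so a crude polynomial bound on \<open>\<phi>\<close> suffices in place of Stirling's formula. The
  differences of low order are recovered because \<open>m\<close> is bounded when \<open>\<Sum> a i \<le> \<Sum> b i\<close>
  (\<open>completely_monotone_of_high_differences\<close>).
\<close>

section \<open>Completely monotone sequences\<close>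

definition backward_diff :: "(nat \<Rightarrow> real) \<Rightarrow> nat \<Rightarrow> real" where
  "backward_diff m n = m n - m (Suc n)"

definition completely_monotone :: "(nat \<Rightarrow> real) \<Rightarrow> bool" where
  "completely_monotone m \<longleftrightarrow> (\<forall>j n. 0 \<le> (backward_diff ^^ j) m n)"

lemma completely_monotoneD: "completely_monotone m \<Longrightarrow> 0 \<le> (backward_diff ^^ j) m n"
  by (simp add: completely_monotone_def)

lemma completely_monotone_nonneg: "completely_monotone m \<Longrightarrow> 0 \<le> m n"
  using completely_monotoneD[of m 0] by simp

lemma completely_monotone_Suc_le: "completely_monotone m \<Longrightarrow> m (Suc n) \<le> m n"
  using completely_monotoneD[of m 1 n] by (simp add: backward_diff_def)

lemma backward_diff_add: "backward_diff (\<lambda>n. f n + g n) = (\<lambda>n. backward_diff f n + backward_diff g n)"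
  by (simp add: backward_diff_def fun_eq_iff)

lemma backward_diff_shift: "backward_diff (\<lambda>n. f (n + k)) = (\<lambda>n. backward_diff f (n + k))"
  by (simp add: backward_diff_def fun_eq_iff)

lemma backward_diff_pow_add:
  "(backward_diff ^^ j) (\<lambda>n. f n + g n) = (\<lambda>n. (backward_diff ^^ j) f n + (backward_diff ^^ j) g n)"
  by (induction j) (simp_all add: backward_diff_add)

lemma backward_diff_pow_shift:
  "(backward_diff ^^ j) (\<lambda>n. f (n + k)) = (\<lambda>n. (backward_diff ^^ j) f (n + k))"
  by (induction j) (simp_all add: backward_diff_shift)

lemma backward_diff_pow_Suc:
  "(backward_diff ^^ Suc j) m n = (backward_diff ^^ j) m n - (backward_diff ^^ j) m (Suc n)"
  by (simp add: backward_diff_def)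

lemma backward_diff_pow_bounded:
  assumes "\<And>n. \<bar>m n\<bar> \<le> B"
  shows "\<bar>(backward_diff ^^ j) m n\<bar> \<le> 2 ^ j * B"
proof (induction j arbitrary: n)
  case 0
  then show ?case using assms by simp
next
  case (Suc j)
  show ?case using Suc[of n] Suc[of "Suc n"] by (simp add: backward_diff_pow_Suc del: funpow.simps)
qed

lemma backward_diff_pow_binomial:
  "(backward_diff ^^ j) m n = (\<Sum>i\<le>j. (-1) ^ i * real (j choose i) * m (n + i))"
proof (induction j arbitrary: m)
  case 0
  then show ?case by simp
next
  case (Suc j)
  have "(backward_diff ^^ Suc j) m n = (backward_diff ^^ j) (backward_diff m) n"
    by (simp add: funpow_swap1)
  also have "\<dots> = (\<Sum>i\<le>j. (-1) ^ i * real (j choose i) * m (n + i))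
      - (\<Sum>i\<le>j. (-1) ^ i * real (j choose i) * m (n + Suc i))"
    by (simp add: Suc.IH backward_diff_def algebra_simps flip: sum_subtractf)
  also have "(\<Sum>i\<le>j. (-1) ^ i * real (j choose i) * m (n + i))
     = m n + (\<Sum>i\<le>j. (-1) ^ Suc i * real (j choose Suc i) * m (n + Suc i))"
    using sum.atMost_Suc_shift[of "\<lambda>i. (-1) ^ i * real (j choose i) * m (n + i)" j]
    by (simp add: binomial_eq_0)
  also have "\<dots> - (\<Sum>i\<le>j. (-1) ^ i * real (j choose i) * m (n + Suc i))
     = m n + (\<Sum>i\<le>j. (-1) ^ Suc i * real (Suc j choose Suc i) * m (n + Suc i))"
    by (simp add: algebra_simps flip: sum.distrib sum_subtractf sum_negf)
  also have "\<dots> = (\<Sum>i\<le>Suc j. (-1) ^ i * real (Suc j choose i) * m (n + i))"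
    by (subst sum.atMost_Suc_shift) simp
  finally show ?case .
qed

lemma completely_monotone_backward_diff:
  "completely_monotone m \<Longrightarrow> completely_monotone (backward_diff m)"
  unfolding completely_monotone_def by (metis funpow_Suc_right o_apply)

lemma completely_monotone_shift:
  "completely_monotone m \<Longrightarrow> completely_monotone (\<lambda>n. m (n + k))"
  by (simp add: completely_monotone_def backward_diff_pow_shift)

text \<open>Induction on the order by the Leibniz rule \<open>D (f g) n = f n * D g n + D f n * g (n + 1)\<close>, which leaves
  only products of completely monotone sequences.\<close>

lemma completely_monotone_mult:
  assumes "completely_monotone f" "completely_monotone g"
  shows "completely_monotone (\<lambda>n. f n * g n)"
proof -
  have "0 \<le> (backward_diff ^^ j) (\<lambda>n. f n * g n) n" for j n
    using assms
  proof (induction j arbitrary: f g n)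
    case 0
    then show ?case by (simp add: completely_monotone_nonneg)
  next
    case (Suc j)
    have eq: "backward_diff (\<lambda>n. f n * g n)
        = (\<lambda>n. f n * backward_diff g n + backward_diff f n * g (n + 1))"
      by (simp add: backward_diff_def fun_eq_iff algebra_simps)
    have "(backward_diff ^^ Suc j) (\<lambda>n. f n * g n) n
       = (backward_diff ^^ j) (\<lambda>n. f n * backward_diff g n) n
         + (backward_diff ^^ j) (\<lambda>n. backward_diff f n * g (n + 1)) n"
      by (simp only: funpow_Suc_right o_apply eq backward_diff_pow_add)
    also have "\<dots> \<ge> 0"
      by (intro add_nonneg_nonneg Suc.IH Suc.prems completely_monotone_backward_diff
            completely_monotone_shift)
    finally show ?case .
  qed
  then show ?thesis by (simp add: completely_monotone_def)
qed

lemma completely_monotone_prod: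
  assumes "finite I" "\<And>i. i \<in> I \<Longrightarrow> completely_monotone (f i)"
  shows "completely_monotone (\<lambda>n. \<Prod>i\<in>I. f i n)"
  using assms
proof (induction I rule: finite_induct)
  case empty
  have "(backward_diff ^^ j) (\<lambda>n. 1) = (if j = 0 then \<lambda>n. 1 else (\<lambda>n. 0))" for j
    by (induction j) (auto simp: backward_diff_def fun_eq_iff)
  then show ?case by (simp add: completely_monotone_def)
next
  case (insert i I)
  then show ?case by (simp add: completely_monotone_mult)
qed

text \<open>These are the moments of the Beta distribution with parameters \<open>a\<close> and \<open>b - a\<close>; the closed form of the
  differences is its integral of \<open>s ^ n * (1 - s) ^ j\<close>.\<close>

lemma completely_monotone_pochhammer_ratio:
  assumes "0 < a" "a < (b::real)"
  shows "completely_monotone (\<lambda>n. pochhammer a n / pochhammer b n)"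
proof -
  have "(backward_diff ^^ j) (\<lambda>n. pochhammer a n / pochhammer b n) n
      = pochhammer a n * pochhammer (b - a) j / pochhammer b (n + j)" for j n
  proof (induction j arbitrary: n)
    case 0
    then show ?case by simp
  next
    case (Suc j)
    have nz: "pochhammer b (n + j) \<noteq> 0" "b + real (n + j) \<noteq> 0"
      using pochhammer_pos[of b "n + j"] assms by auto
    have "(backward_diff ^^ Suc j) (\<lambda>n. pochhammer a n / pochhammer b n) n
       = pochhammer a n * pochhammer (b - a) j / pochhammer b (n + j)
         - pochhammer a (Suc n) * pochhammer (b - a) j / pochhammer b (Suc (n + j))"
      by (simp add: backward_diff_pow_Suc Suc del: funpow.simps)
    also have "\<dots> = pochhammer a n * pochhammer (b - a) (Suc j) / pochhammer b (n + Suc j)"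
    proof -
      define P where "P = pochhammer b (n + j)"
      define c where "c = b + real (n + j)"
      have "P \<noteq> 0" "c \<noteq> 0" using nz by (simp_all add: P_def c_def)
      moreover have "a + real n = c - (b - a + real j)" by (simp add: c_def)
      ultimately show ?thesis
        by (simp add: pochhammer_Suc divide_simps flip: P_def c_def of_nat_add)
           (simp add: algebra_simps)
    qed
    finally show ?case .
  qed
  then show ?thesis
    using assms by (auto simp: completely_monotone_def intro!: divide_nonneg_pos mult_nonneg_nonneg
        pochhammer_nonneg pochhammer_pos)
qed

text \<open>A bounded sequence whose differences decrease cannot ever have a negative difference: that
  difference would persist and drive the sequence to infinity. Hence the sign of the high
  differences passes down to the low ones.\<close>

lemma backward_diff_nonneg_of_bounded:
  assumes bnd: "\<And>n. \<bar>h n\<bar> \<le> B"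
    and second: "\<And>n. 0 \<le> backward_diff (backward_diff h) n"
  shows "0 \<le> backward_diff h n"
proof (rule ccontr)
  assume neg: "\<not> 0 \<le> backward_diff h n"
  define c where "c = - backward_diff h n"
  have c: "c > 0" using neg by (simp add: c_def)
  have "antimono (backward_diff h)"
  proof (rule decseq_SucI)
    show "backward_diff h (Suc k) \<le> backward_diff h k" for k
      using second[of k] by (simp add: backward_diff_def)
  qed
  then have step: "h (Suc k) \<ge> h k + c" if "k \<ge> n" for k
    using that antimonoD[of "backward_diff h" n k] by (simp add: c_def backward_diff_def)
  have grow: "h (n + k) \<ge> h n + real k * c" for k
  proof (induction k)
    case (Suc k)
    then show ?case using step[of "n + k"] by (simp add: algebra_simps)
  qed simp
  obtain k where "real k * c > 2 * B"
    using c reals_Archimedean3 by blast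
  then show False using grow[of k] bnd[of n] bnd[of "n + k"] by linarith
qed

text \<open>Descending induction on the order, starting at \<open>J\<close>. It makes up for the fact that loop integrals control
  only differences of high order.\<close>

lemma completely_monotone_of_high_differences:
  assumes pos: "\<And>n. 0 \<le> m n"
    and bnd: "\<And>n. \<bar>m n\<bar> \<le> B"
    and high: "\<And>j n. j \<ge> J \<Longrightarrow> 0 \<le> (backward_diff ^^ j) m n"
  shows "completely_monotone m"
proof -
  have down: "0 \<le> (backward_diff ^^ j) m n"
    if "\<And>n. 0 \<le> (backward_diff ^^ Suc j) m n" "j \<ge> 1" for j n
  proof -
    obtain i where i: "j = Suc i" using \<open>j \<ge> 1\<close> by (cases j) auto
    show ?thesis
      using backward_diff_nonneg_of_bounded[of "(backward_diff ^^ i) m" "2 ^ i * B" n]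
        backward_diff_pow_bounded[of m B i] bnd that(1) by (simp add: i)
  qed
  have "\<forall>n. 0 \<le> (backward_diff ^^ j) m n" if "j \<ge> 1" for j
  proof (cases "j \<ge> J")
    case True
    then show ?thesis using high by blast
  next
    case False
    then have "j \<le> J" by simp
    then show ?thesis using \<open>j \<ge> 1\<close>
    proof (induction rule: inc_induct)
      case base
      then show ?case using high by blast
    next
      case (step i)
      then show ?case using down[of i] by simp
    qed
  qed
  moreover have "0 \<le> (backward_diff ^^ 0) m n" for n using pos by simp
  ultimately show ?thesis
    unfolding completely_monotone_def by (metis One_nat_def Suc_leI neq0_conv)
qed

section \<open>Bernstein weights\<close>

text \<open>The \<open>N\<close>-th Bernstein polynomials integrate to these weights under any measure with moments \<open>m\<close>, because
  \<open>(backward_diff ^^ j) m k\<close> is then the integral of \<open>s ^ k * (1 - s) ^ j\<close>. The weight belongs to the node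
  \<open>k / N\<close>.\<close>

definition bernstein_weight :: "(nat \<Rightarrow> real) \<Rightarrow> nat \<Rightarrow> nat \<Rightarrow> real" where
  "bernstein_weight m N k = real (N choose k) * (backward_diff ^^ (N - k)) m k"

lemma bernstein_weight_nonneg: "completely_monotone m \<Longrightarrow> 0 \<le> bernstein_weight m N k"
  by (simp add: bernstein_weight_def completely_monotoneD)

text \<open>The binomial theorem for the commuting operators shift and backward difference, whose sum is the
  identity.\<close>

lemma sum_binomial_backward_diff:
  "(\<Sum>k\<le>M. real (M choose k) * (backward_diff ^^ (M - k)) m (n + k)) = m n"
proof (induction M arbitrary: m n)
  case 0
  then show ?case by simp
next
  case (Suc M)
  let ?D = backward_diff
  have "(\<Sum>k\<le>Suc M. real (Suc M choose k) * (?D ^^ (Suc M - k)) m (n + k))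
      = (?D ^^ Suc M) m n + (\<Sum>k\<le>M. real (Suc M choose Suc k) * (?D ^^ (M - k)) m (n + Suc k))"
    by (subst sum.atMost_Suc_shift) simp
  also have "(\<Sum>k\<le>M. real (Suc M choose Suc k) * (?D ^^ (M - k)) m (n + Suc k))
      = (\<Sum>k\<le>M. real (M choose k) * (?D ^^ (M - k)) m (Suc n + k))
        + (\<Sum>k\<le>M. real (M choose Suc k) * (?D ^^ (M - k)) m (n + Suc k))"
    by (simp add: algebra_simps flip: sum.distrib)
  also have "(\<Sum>k\<le>M. real (M choose k) * (?D ^^ (M - k)) m (Suc n + k)) = m (Suc n)"
    by (rule Suc.IH)
  also have "(?D ^^ Suc M) m n + (m (Suc n) +
       (\<Sum>k\<le>M. real (M choose Suc k) * (?D ^^ (M - k)) m (n + Suc k)))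
     = m (Suc n) + (\<Sum>k\<le>Suc M. real (M choose k) * (?D ^^ (Suc M - k)) m (n + k))"
    by (subst sum.atMost_Suc_shift) simp
  also have "(\<Sum>k\<le>Suc M. real (M choose k) * (?D ^^ (Suc M - k)) m (n + k))
     = (\<Sum>k\<le>M. real (M choose k) * (?D ^^ (M - k)) (?D m) (n + k))"
    by (simp add: Suc_diff_le funpow_swap1)
  also have "\<dots> = ?D m n" by (rule Suc.IH)
  finally show ?case by (simp add: backward_diff_def)
qed

text \<open>Factorial moments are reproduced exactly: \<open>(N choose k) * (k choose n) = (N choose n) * (N - n choose k - n)\<close>
  reduces them to the previous identity.\<close>

lemma sum_choose_bernstein_weight:
  assumes "n \<le> N"
  shows "(\<Sum>k\<le>N. real (k choose n) * bernstein_weight m N k) = real (N choose n) * m n"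
proof -
  obtain M where N: "N = n + M" using assms le_Suc_ex by blast
  have "(\<Sum>k\<le>N. real (k choose n) * bernstein_weight m N k)
      = (\<Sum>k=n..N. real (k choose n) * bernstein_weight m N k)"
    by (rule sum.mono_neutral_right) (auto simp: binomial_eq_0 not_le)
  also have "\<dots> = (\<Sum>k\<le>M. real ((n + k) choose n) * bernstein_weight m N (n + k))"
    by (rule sum.reindex_bij_witness[where i = "\<lambda>k. n + k" and j = "\<lambda>k. k - n"]) (auto simp: N)
  also have "\<dots> = (\<Sum>k\<le>M. real (N choose n) * (real (M choose k) * (backward_diff ^^ (M - k)) m (n + k)))"
  proof (rule sum.cong[OF refl])
    fix k assume "k \<in> {..M}"
    then have "(N choose (n + k)) * ((n + k) choose n) = (N choose n) * (M choose k)"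
      using choose_mult[of n "n + k" N] by (simp add: N)
    then have "real ((n + k) choose n) * real (N choose (n + k)) = real (N choose n) * real (M choose k)"
      by (metis mult.commute of_nat_mult)
    then show "real ((n + k) choose n) * bernstein_weight m N (n + k)
        = real (N choose n) * (real (M choose k) * (backward_diff ^^ (M - k)) m (n + k))"
      by (simp add: bernstein_weight_def N)
  qed
  also have "\<dots> = real (N choose n) * m n"
    by (simp add: sum_binomial_backward_diff flip: sum_distrib_left)
  finally show ?thesis .
qed

lemma sum_bernstein_weight: "(\<Sum>k\<le>N. bernstein_weight m N k) = m 0"
  using sum_choose_bernstein_weight[of 0 N m] by simp

definition bernstein_moment :: "(nat \<Rightarrow> real) \<Rightarrow> nat \<Rightarrow> nat \<Rightarrow> real" where
  "bernstein_moment m n N = (\<Sum>k\<le>N. bernstein_weight m N k * (real k / real N) ^ n)"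

lemma bernstein_moment_1:
  assumes "N \<ge> 1"
  shows "bernstein_moment m 1 N = m 1"
proof -
  have "real N * bernstein_moment m 1 N = (\<Sum>k\<le>N. real (k choose 1) * bernstein_weight m N k)"
    using assms by (auto simp: bernstein_moment_def sum_distrib_left intro!: sum.cong)
  also have "\<dots> = real N * m 1"
    using assms by (subst sum_choose_bernstein_weight) auto
  finally show ?thesis using assms by simp
qed

text \<open>Both terms are products of \<open>n\<close> factors of modulus at most 1, with factorwise difference at most
  \<open>n / (N - n)\<close>. This carries the exact factorial moments over to power moments.\<close>

lemma choose_ratio_approx:
  assumes "k \<le> N" "2 * n < N"
  shows "\<bar>(real k / real N) ^ n - real (k choose n) / real (N choose n)\<bar> \<le> real n * real n / (real N - real n)"
proof -
  have N: "N > 0" "N > n" using assms by auto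
  have eq: "real (k choose n) / real (N choose n) = (\<Prod>j<n. (real k - real j) / (real N - real j))"
    by (simp add: binomial_gbinomial gbinomial_prod_rev prod_dividef lessThan_atLeast0)
  have "\<bar>(\<Prod>j<n. real k / real N) - (\<Prod>j<n. (real k - real j) / (real N - real j))\<bar>
      \<le> (\<Sum>j<n. \<bar>real k / real N - (real k - real j) / (real N - real j)\<bar>)"
    unfolding real_norm_def[symmetric]
  proof (rule norm_prod_diff)
    fix j assume "j \<in> {..<n}"
    then have "real j < real n" by simp
    moreover have "2 * real n < real N" "real k \<le> real N" using assms by linarith+
    ultimately have "\<bar>real k - real j\<bar> \<le> real N - real j" "0 < real N - real j" by linarith+
    then show "norm ((real k - real j) / (real N - real j)) \<le> 1"
      by (simp add: abs_divide divide_le_eq)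
    show "norm (real k / real N) \<le> 1" using assms N by simp
  qed
  also have "\<dots> \<le> (\<Sum>j<n. real n / (real N - real n))"
  proof (rule sum_mono)
    fix j assume "j \<in> {..<n}"
    then have j: "real j < real n" "real n < real N" using N by auto
    have *: "real k / real N - (real k - real j) / (real N - real j)
       = real j * ((real N - real k) / real N) / (real N - real j)"
      using j by (simp add: field_simps)
    have "0 \<le> (real N - real k) / real N" "(real N - real k) / real N \<le> 1"
      using assms N by (auto simp: field_simps)
    then have "\<bar>real k / real N - (real k - real j) / (real N - real j)\<bar>
        = real j * ((real N - real k) / real N) / (real N - real j)"
      unfolding *
      by (intro abs_of_nonneg divide_nonneg_pos mult_nonneg_nonneg) (use j assms in auto)
    also have "\<dots> \<le> real n * 1 / (real N - real n)"
      using j \<open>(real N - real k) / real N \<le> 1\<close> \<open>0 \<le> (real N - real k) / real N\<close>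
      by (intro frac_le mult_mono mult_nonneg_nonneg) auto
    finally show "\<bar>real k / real N - (real k - real j) / (real N - real j)\<bar> \<le> real n / (real N - real n)"
      by simp
  qed
  finally show ?thesis by (simp add: eq)
qed

lemma bernstein_moment_tendsto:
  assumes cm: "completely_monotone m"
  shows "bernstein_moment m n \<longlonglongrightarrow> m n"
proof (rule LIM_zero_cancel, rule Lim_null_comparison)
  show "\<forall>\<^sub>F N in sequentially. norm (bernstein_moment m n N - m n)
      \<le> m 0 * (real n * real n / (real N - real n))"
    using eventually_gt_at_top[of "2 * n"]
  proof eventually_elim
    case (elim N)
    have nz: "real (N choose n) \<noteq> 0" using elim by simp
    have "m n = (\<Sum>k\<le>N. bernstein_weight m N k * (real (k choose n) / real (N choose n)))"
      using sum_choose_bernstein_weight[of n N m] elim nz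
      by (simp add: field_simps flip: sum_divide_distrib)
    then have "bernstein_moment m n N - m n
       = (\<Sum>k\<le>N. bernstein_weight m N k * ((real k / real N) ^ n - real (k choose n) / real (N choose n)))"
      by (simp add: bernstein_moment_def right_diff_distrib sum_subtractf)
    also have "\<bar>\<dots>\<bar> \<le> (\<Sum>k\<le>N. bernstein_weight m N k * (real n * real n / (real N - real n)))"
    proof (intro order_trans[OF sum_abs] sum_mono)
      fix k assume "k \<in> {..N}"
      then show "\<bar>bernstein_weight m N k * ((real k / real N) ^ n - real (k choose n) / real (N choose n))\<bar>
          \<le> bernstein_weight m N k * (real n * real n / (real N - real n))"
        unfolding abs_mult using bernstein_weight_nonneg[OF cm, of N k] choose_ratio_approx[of k N n] elim
        by (intro mult_mono) auto
    qed
    also have "\<dots> = m 0 * (real n * real n / (real N - real n))"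
      by (simp only: sum_bernstein_weight flip: sum_distrib_right)
    finally show ?case by simp
  qed
  show "(\<lambda>N. m 0 * (real n * real n / (real N - real n))) \<longlonglongrightarrow> 0"
    by real_asymp
qed

lemma bernstein_moment_nonneg: "completely_monotone m \<Longrightarrow> 0 \<le> bernstein_moment m n N"
  by (simp add: bernstein_moment_def bernstein_weight_nonneg sum_nonneg)

lemma bernstein_moment_le:
  assumes "completely_monotone m"
  shows "bernstein_moment m n N \<le> m 0"
proof -
  have "bernstein_moment m n N \<le> (\<Sum>k\<le>N. bernstein_weight m N k * 1)"
    unfolding bernstein_moment_def using bernstein_weight_nonneg[OF assms]
    by (intro sum_mono mult_left_mono power_le_one) (auto simp: divide_le_eq)
  then show ?thesis by (simp add: sum_bernstein_weight)
qed

section \<open>Continuation by Bernstein sums\<close>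

lemma slit_kernel_not_nonpos_Reals:
  assumes "y \<in> UNIV - complex_of_real ` {1..}" "0 \<le> s" "s \<le> 1"
  shows "1 - of_real s * y \<notin> \<real>\<^sub>\<le>\<^sub>0"
proof
  assume "1 - of_real s * y \<in> \<real>\<^sub>\<le>\<^sub>0"
  then obtain r where r: "1 - of_real s * y = of_real r" "r \<le> 0"
    by (auto elim!: nonpos_Reals_cases)
  then have sy: "of_real s * y = of_real (1 - r)" by (simp add: algebra_simps)
  then have "s \<noteq> 0" using r by (auto simp: complex_eq_iff)
  then have "y = of_real ((1 - r) / s)" using sy by (simp add: field_simps)
  moreover have "(1 - r) / s \<ge> 1" using r assms \<open>s \<noteq> 0\<close> by (simp add: le_divide_eq)
  ultimately show False using assms(1) by blast
qed

text \<open>On the slit plane the principal branch is regular for all \<open>s\<close> in \<open>[0, 1]\<close>; the exponential form makes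
  this continuous in \<open>s\<close> and \<open>y\<close> jointly.\<close>

lemma slit_kernel_eq_exp:
  assumes "y \<in> UNIV - complex_of_real ` {1..}" "0 \<le> s" "s \<le> 1"
  shows "(1 - of_real s * y) powr c = exp (c * Ln (1 - of_real s * y))"
  using slit_kernel_not_nonpos_Reals[OF assms] by (auto simp: powr_def)

lemma open_slit: "open (UNIV - complex_of_real ` {1..})"
proof -
  have "complex_of_real ` {1..} = {z. Im z = 0} \<inter> {z. Re z \<ge> 1}"
    by (auto simp: complex_eq_iff image_iff)
  moreover have "closed {z. Im z = 0}" "closed {z. Re z \<ge> 1}"
    by (intro closed_Collect_eq closed_Collect_le continuous_intros)+
  ultimately show ?thesis by (simp add: closed_Int open_Diff)
qed

lemma connected_slit: "connected (UNIV - complex_of_real ` {1..})"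
proof (rule starlike_imp_connected)
  show "starlike (UNIV - complex_of_real ` {1..})"
    unfolding starlike_def
  proof (intro bexI ballI subsetI)
    fix y z assume y: "y \<in> UNIV - complex_of_real ` {1..}" and "z \<in> closed_segment 0 y"
    then obtain u where u: "0 \<le> u" "u \<le> 1" "z = of_real u * y"
      by (auto simp: in_segment scaleR_conv_of_real)
    have "1 - z \<notin> \<real>\<^sub>\<le>\<^sub>0" using slit_kernel_not_nonpos_Reals[OF y u(1,2)] u(3) by simp
    moreover have "1 - complex_of_real r \<in> \<real>\<^sub>\<le>\<^sub>0" if "r \<ge> 1" for r
      using that by (metis diff_le_0_iff_le nonpos_Reals_of_real_iff of_real_1 of_real_diff)
    ultimately show "z \<in> UNIV - complex_of_real ` {1..}" by auto
  next
    show "0 \<in> UNIV - complex_of_real ` {1..}" by auto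
  qed
qed

lemma slit_kernel_holomorphic:
  assumes "0 \<le> s" "s \<le> 1"
  shows "(\<lambda>y. (1 - of_real s * y) powr c) holomorphic_on (UNIV - complex_of_real ` {1..})"
proof -
  have "(\<lambda>y. exp (c * Ln (1 - of_real s * y))) holomorphic_on (UNIV - complex_of_real ` {1..})"
    using slit_kernel_not_nonpos_Reals assms by (intro holomorphic_intros) auto
  then show ?thesis
    by (rule holomorphic_transform) (use slit_kernel_eq_exp assms in auto)
qed

lemma slit_kernel_bounded:
  assumes "compact K" "K \<subseteq> UNIV - complex_of_real ` {1..}"
  shows "\<exists>B. \<forall>s\<in>{0..1}. \<forall>y\<in>K. norm ((1 - of_real s * y) powr c) \<le> B"
proof -
  let ?f = "\<lambda>p. exp (c * Ln (1 - of_real (fst p) * snd p))"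
  have "continuous_on ({0..1} \<times> K) ?f"
    using slit_kernel_not_nonpos_Reals assms(2) by (intro continuous_intros) auto
  then have "compact (?f ` ({0..1} \<times> K))"
    by (intro compact_continuous_image compact_Times compact_Icc assms)
  then obtain B where B: "\<And>z. z \<in> ?f ` ({0..1} \<times> K) \<Longrightarrow> norm z \<le> B"
    by (meson bounded_iff compact_imp_bounded)
  show ?thesis
  proof (intro exI ballI)
    fix s :: real and y assume *: "s \<in> {0..1}" "y \<in> K"
    then have "norm (?f (s, y)) \<le> B" by (intro B imageI) simp
    then show "norm ((1 - of_real s * y) powr c) \<le> B"
      using slit_kernel_eq_exp[of y s c] subsetD[OF assms(2) *(2)] *(1) by simp
  qed
qed

text \<open>The integral of the Stieltjes kernel against the Bernstein weights.\<close>

definition bernstein_sum :: "(nat \<Rightarrow> real) \<Rightarrow> real \<Rightarrow> nat \<Rightarrow> complex \<Rightarrow> complex" where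
  "bernstein_sum m \<sigma> N y =
     (\<Sum>k\<le>N. of_real (bernstein_weight m N k) * (1 - of_real (real k / real N) * y) powr (- of_real \<sigma>))"

lemma kernel_series:
  assumes "norm y < 1" "0 \<le> s" "s \<le> 1"
  shows "(\<lambda>n. of_real (pochhammer \<sigma> n / fact n) * y ^ n * of_real (s ^ n))
           sums (1 - of_real s * y) powr (- of_real \<sigma> :: complex)"
proof -
  have "norm (- (of_real s * y)) < 1"
    using assms by (simp add: norm_mult) (meson le_less_trans mult_left_le_one_le norm_ge_zero)
  from gen_binomial_complex[OF this, of "- of_real \<sigma>"]
  have "(\<lambda>n. (- of_real \<sigma> gchoose n) * (- (of_real s * y)) ^ n) sums (1 - of_real s * y) powr (- of_real \<sigma> :: complex)"
    by simp
  moreover have "(- of_real \<sigma> gchoose n) * (- (of_real s * y)) ^ n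
      = of_real (pochhammer \<sigma> n / fact n) * y ^ n * of_real (s ^ n)" for n
  proof -
    have "(- (of_real s * y)) ^ n = (-1) ^ n * of_real s ^ n * y ^ n"
      by (metis mult_minus1 power_mult_distrib mult.assoc)
    moreover have "(-1 :: complex) ^ n * (-1) ^ n = 1"
      by (simp flip: power_mult_distrib)
    ultimately show ?thesis
      by (simp add: gbinomial_pochhammer pochhammer_of_real)
  qed
  ultimately show ?thesis by simp
qed

lemma bernstein_sum_series:
  assumes "norm y < 1"
  shows "bernstein_sum m \<sigma> N y = (\<Sum>n. of_real (pochhammer \<sigma> n / fact n) * y ^ n * of_real (bernstein_moment m n N))"
proof -
  have "(\<lambda>n. \<Sum>k\<le>N. of_real (bernstein_weight m N k)
           * (of_real (pochhammer \<sigma> n / fact n) * y ^ n * of_real ((real k / real N) ^ n)))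
      sums bernstein_sum m \<sigma> N y"
    unfolding bernstein_sum_def
    by (intro sums_sum sums_mult kernel_series assms) (auto simp: divide_le_eq)
  moreover have "(\<Sum>k\<le>N. of_real (bernstein_weight m N k)
           * (of_real (pochhammer \<sigma> n / fact n) * y ^ n * of_real ((real k / real N) ^ n)))
      = of_real (pochhammer \<sigma> n / fact n) * y ^ n * of_real (bernstein_moment m n N)" for n
    by (simp add: bernstein_moment_def sum_distrib_left mult_ac)
  ultimately show ?thesis by (simp add: sums_iff)
qed

text \<open>The coefficients converge with the moments, and \<open>m 0\<close> bounds all of them, so Tannery's theorem applies.\<close>

lemma bernstein_sum_tendsto_series:
  assumes cm: "completely_monotone m" and y: "norm y < 1" and \<sigma>: "\<sigma> > 0"
  shows "(\<lambda>N. bernstein_sum m \<sigma> N y)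
      \<longlonglongrightarrow> (\<Sum>n. of_real (pochhammer \<sigma> n / fact n) * y ^ n * of_real (m n))"
proof -
  have sm: "summable (\<lambda>n. norm (of_real (pochhammer \<sigma> n / fact n) * y ^ n) * m 0)"
  proof (rule summable_mult2)
    have "summable (\<lambda>n. of_real (pochhammer \<sigma> n / fact n) * (of_real (norm y)) ^ n * of_real (1 ^ n) :: complex)"
      by (rule sums_summable, rule kernel_series) (use y in auto)
    then have "summable (\<lambda>n. complex_of_real (pochhammer \<sigma> n / fact n * norm y ^ n))"
      by simp
    then have "summable (\<lambda>n. pochhammer \<sigma> n / fact n * norm y ^ n)"
      by (subst (asm) summable_of_real_iff)
    then show "summable (\<lambda>n. norm (of_real (pochhammer \<sigma> n / fact n) * y ^ n))"
      using \<sigma> by (simp add: norm_mult norm_power norm_divide pochhammer_nonneg)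
  qed
  have "(\<lambda>N. \<Sum>n. of_real (pochhammer \<sigma> n / fact n) * y ^ n * of_real (bernstein_moment m n N))
     \<longlonglongrightarrow> (\<Sum>n. of_real (pochhammer \<sigma> n / fact n) * y ^ n * of_real (m n))"
  proof (rule tannerys_theorem[OF _ _ sm, THEN conjunct2, THEN conjunct2])
    show "(\<lambda>N. of_real (pochhammer \<sigma> n / fact n) * y ^ n * of_real (bernstein_moment m n N))
        \<longlonglongrightarrow> of_real (pochhammer \<sigma> n / fact n) * y ^ n * of_real (m n)" for n
      by (intro tendsto_intros bernstein_moment_tendsto cm)
    show "\<forall>\<^sub>F (n, N) in at_top \<times>\<^sub>F sequentially.
        norm (of_real (pochhammer \<sigma> n / fact n) * y ^ n * of_real (bernstein_moment m n N))
          \<le> norm (of_real (pochhammer \<sigma> n / fact n) * y ^ n) * m 0"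
    proof (intro always_eventually allI, clarify)
      fix n N
      have "norm (complex_of_real (bernstein_moment m n N)) \<le> m 0"
        using bernstein_moment_nonneg[OF cm] bernstein_moment_le[OF cm] by simp
      then show "norm (of_real (pochhammer \<sigma> n / fact n) * y ^ n * of_real (bernstein_moment m n N))
          \<le> norm (of_real (pochhammer \<sigma> n / fact n) * y ^ n) * m 0"
        unfolding norm_mult by (intro mult_left_mono) auto
    qed
  qed simp
  then show ?thesis using y by (simp add: bernstein_sum_series)
qed

text \<open>The Bernstein sums are uniformly bounded on compact subsets of the slit plane, so Montel's
  theorem extracts a holomorphic limit; on the unit disc the limit is the power series. This proves that
  the continuation exists, and connectedness of the slit plane identifies it with \<open>hyp_F\<close>.\<close>

lemma hyp_F_eq_lim_bernstein_sum:
  assumes cm: "completely_monotone m" and \<sigma>: "\<sigma> > 0"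
    and m: "\<And>n. m n = (\<Prod>i=1..q. pochhammer (a i) n) / (\<Prod>i=1..q. pochhammer (b i) n)"
  obtains r where "strict_mono (r :: nat \<Rightarrow> nat)"
    "\<And>y. y \<in> UNIV - complex_of_real ` {1..} \<Longrightarrow> (\<lambda>N. bernstein_sum m \<sigma> (r N) y) \<longlonglongrightarrow> hyp_F q \<sigma> a b y"
proof -
  let ?S = "UNIV - complex_of_real ` {1..}"
  have hol: "bernstein_sum m \<sigma> N holomorphic_on ?S" for N
    unfolding bernstein_sum_def
    by (intro holomorphic_intros slit_kernel_holomorphic) (auto simp: divide_le_eq)
  have bnd: "\<exists>B. \<forall>h\<in>range (bernstein_sum m \<sigma>). \<forall>z\<in>K. norm (h z) \<le> B"
    if K: "compact K" "K \<subseteq> ?S" for K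
  proof -
    obtain B where B: "\<forall>s\<in>{0..1}. \<forall>y\<in>K. norm ((1 - of_real s * y) powr (- of_real \<sigma>)) \<le> B"
      using slit_kernel_bounded[OF K, of "- of_real \<sigma>"] by blast
    have "norm (bernstein_sum m \<sigma> N y) \<le> m 0 * B" if "y \<in> K" for N y
    proof -
      have "norm (bernstein_sum m \<sigma> N y) \<le> (\<Sum>k\<le>N. bernstein_weight m N k * B)"
        unfolding bernstein_sum_def
      proof (rule sum_norm_le)
        fix k assume "k \<in> {..N}"
        then have "norm ((1 - of_real (real k / real N) * y) powr (- of_real \<sigma>)) \<le> B"
          using that by (intro B[rule_format]) (simp_all add: divide_le_eq)
        then show "norm (of_real (bernstein_weight m N k) * (1 - of_real (real k / real N) * y) powr (- of_real \<sigma>))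
            \<le> bernstein_weight m N k * B"
          unfolding norm_mult norm_of_real using bernstein_weight_nonneg[OF cm, of N k]
          by (intro mult_mono) auto
      qed
      also have "\<dots> = m 0 * B" by (simp only: sum_bernstein_weight flip: sum_distrib_right)
      finally show ?thesis .
    qed
    then show ?thesis by blast
  qed
  obtain g r where g: "g holomorphic_on ?S" and r: "strict_mono r"
    and lim: "\<And>y. y \<in> ?S \<Longrightarrow> (\<lambda>N. bernstein_sum m \<sigma> (r N) y) \<longlonglongrightarrow> g y"
  proof (rule Montel[of ?S "range (bernstein_sum m \<sigma>)" "bernstein_sum m \<sigma>", OF open_slit])
    show "h holomorphic_on ?S" if "h \<in> range (bernstein_sum m \<sigma>)" for h
      using that hol by auto
  qed (use bnd in simp_all)
  have disc: "y \<in> ?S" if "norm y < 1" for y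
    using that by (auto simp: image_iff)
  have ser: "g y = hyp_series q \<sigma> a b y" if y: "norm y < 1" for y
  proof -
    have "(\<lambda>N. bernstein_sum m \<sigma> (r N) y)
        \<longlonglongrightarrow> (\<Sum>n. of_real (pochhammer \<sigma> n / fact n) * y ^ n * of_real (m n))"
      using LIMSEQ_subseq_LIMSEQ[OF bernstein_sum_tendsto_series[OF cm y \<sigma>] r] by (simp add: o_def)
    with lim[OF disc[OF y]] have "g y = (\<Sum>n. of_real (pochhammer \<sigma> n / fact n) * y ^ n * of_real (m n))"
      by (rule LIMSEQ_unique)
    also have "\<dots> = hyp_series q \<sigma> a b y"
      unfolding hyp_series_def by (intro suminf_cong) (simp add: m mult_ac)
    finally show ?thesis .
  qed
  have F: "hyp_F q \<sigma> a b holomorphic_on ?S \<and> (\<forall>y. norm y < 1 \<longrightarrow> hyp_F q \<sigma> a b y = hyp_series q \<sigma> a b y)"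
    unfolding hyp_F_def by (rule someI[of _ g]) (use g ser in auto)
  have "hyp_F q \<sigma> a b y = g y" if "y \<in> ?S" for y
  proof (rule analytic_continuation_open[of "ball 0 1" ?S "hyp_F q \<sigma> a b" g])
    show "ball 0 1 \<subseteq> ?S" using disc by auto
  qed (use F g ser that open_slit connected_slit in auto)
  then show ?thesis using that r lim by simp
qed

section \<open>Strict Jensen and chord bounds\<close>

text \<open>The quadratic term is what makes the final inequalities strict: plain convexity would only give weak
  ones after the passage to the limit.\<close>

lemma stieltjes_kernel_strongly_convex:
  fixes x \<sigma> :: real
  assumes "\<sigma> > 0" "x > -1" "x \<noteq> 0"
  obtains c where "c > 0" "convex_on {0..1} (\<lambda>s. (1 + x * s) powr (- \<sigma>) - c * s\<^sup>2)"
proof -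
  define A where "A = 1 + \<bar>x\<bar>"
  \<comment> \<open>Half of a lower bound for the second derivative of the kernel on the unit interval.\<close>
  define c where "c = \<sigma> * (\<sigma> + 1) * x\<^sup>2 * A powr (- \<sigma> - 2) / 2"
  have A: "A > 0" by (simp add: A_def)
  have pos: "1 + x * s > 0" if "s \<in> {0..1}" for s
  proof (cases "x \<ge> 0")
    case True
    then show ?thesis using that by (simp add: add_pos_nonneg)
  next
    case False
    then have "x * s \<ge> x * 1" using that by (intro mult_left_mono_neg) auto
    then show ?thesis using assms by simp
  qed
  have le: "1 + x * s \<le> A" if "s \<in> {0..1}" for s
  proof -
    have "x * s \<le> \<bar>x\<bar> * s" using that by (intro mult_right_mono) auto
    also have "\<dots> \<le> \<bar>x\<bar> * 1" using that by (intro mult_left_mono) auto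
    finally show ?thesis by (simp add: A_def)
  qed
  have "convex_on {0..1} (\<lambda>s. (1 + x * s) powr (- \<sigma>) - c * s\<^sup>2)"
  proof (rule f''_ge0_imp_convex)
    fix s :: real assume s: "s \<in> {0..1}"
    have d: "((\<lambda>s. (1 + x * s) powr p) has_real_derivative p * x * (1 + x * s) powr (p - 1)) (at s)" for p
      using pos[OF s] by (auto intro!: derivative_eq_intros simp: powr_diff field_simps)
    show "((\<lambda>s. (1 + x * s) powr (- \<sigma>) - c * s\<^sup>2) has_real_derivative
        (- \<sigma> * x * (1 + x * s) powr (- \<sigma> - 1) - 2 * c * s)) (at s)"
      using DERIV_diff[OF d[of "- \<sigma>"] DERIV_cmult[OF DERIV_pow[of 2 s], of c]] by (simp add: mult_ac)
    show "((\<lambda>s. - \<sigma> * x * (1 + x * s) powr (- \<sigma> - 1) - 2 * c * s) has_real_derivative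
        (\<sigma> * (\<sigma> + 1) * x\<^sup>2 * (1 + x * s) powr (- \<sigma> - 2) - 2 * c)) (at s)"
      using DERIV_diff[OF DERIV_cmult[OF d[of "- \<sigma> - 1"], of "- \<sigma> * x"] DERIV_cmult[OF DERIV_ident, of "2 * c"]]
      by (simp add: power2_eq_square algebra_simps)
    have "A powr (- \<sigma> - 2) \<le> (1 + x * s) powr (- \<sigma> - 2)"
      using pos[OF s] le[OF s] assms by (intro powr_mono2') auto
    then have "\<sigma> * (\<sigma> + 1) * x\<^sup>2 * A powr (- \<sigma> - 2) \<le> \<sigma> * (\<sigma> + 1) * x\<^sup>2 * (1 + x * s) powr (- \<sigma> - 2)"
      using assms by (intro mult_left_mono) auto
    then show "0 \<le> \<sigma> * (\<sigma> + 1) * x\<^sup>2 * (1 + x * s) powr (- \<sigma> - 2) - 2 * c"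
      by (simp add: c_def)
  qed simp
  moreover have "c > 0" using assms A by (simp add: c_def)
  ultimately show ?thesis using that by blast
qed

definition bernstein_sum_real :: "(nat \<Rightarrow> real) \<Rightarrow> real \<Rightarrow> nat \<Rightarrow> real \<Rightarrow> real" where
  "bernstein_sum_real m \<sigma> N x = (\<Sum>k\<le>N. bernstein_weight m N k * (1 + x * (real k / real N)) powr (- \<sigma>))"

lemma bernstein_sum_of_real:
  assumes "x > -1"
  shows "bernstein_sum m \<sigma> N (of_real (- x)) = of_real (bernstein_sum_real m \<sigma> N x)"
proof -
  have pos: "1 + x * s \<ge> 0" if "0 \<le> s" "s \<le> 1" for s
  proof -
    have "(-1) * s \<le> x * s" using that assms by (intro mult_right_mono) auto
    then show ?thesis using that by simp
  qed
  have "(1 - of_real (real k / real N) * of_real (- x)) powr (- of_real \<sigma>)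
      = complex_of_real ((1 + x * (real k / real N)) powr (- \<sigma>))" if "k \<le> N" for k
  proof -
    have "1 - of_real (real k / real N) * of_real (- x) = complex_of_real (1 + x * (real k / real N))"
      by (simp add: mult.commute)
    moreover have "1 + x * (real k / real N) \<ge> 0"
      by (intro pos) (use that in \<open>auto simp: divide_le_eq\<close>)
    ultimately show ?thesis by (metis of_real_minus powr_of_real)
  qed
  then show ?thesis
    unfolding bernstein_sum_def bernstein_sum_real_def of_real_sum of_real_mult
    by (intro sum.cong arg_cong2[of _ _ _ _ "(*)"]) auto
qed

text \<open>Jensen's inequality and the chord bound, applied to the convex function \<open>h\<close> that remains after
  subtraction of \<open>c * s\<^sup>2\<close>. The weights have total mass 1 and mean exactly \<open>m 1\<close> for every \<open>N \<ge> 1\<close>.\<close>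

lemma bernstein_sum_real_bounds:
  assumes cm: "completely_monotone m" and m0: "m 0 = 1" and N: "N \<ge> 1"
    and cvx: "convex_on {0..1} (\<lambda>s. (1 + x * s) powr (- \<sigma>) - c * s\<^sup>2)"
    and x: "x > -1"
  shows "(1 + x * m 1) powr (- \<sigma>) + c * (bernstein_moment m 2 N - (m 1)\<^sup>2) \<le> bernstein_sum_real m \<sigma> N x"
    and "bernstein_sum_real m \<sigma> N x \<le> (1 - m 1) + m 1 * (1 + x) powr (- \<sigma>) - c * (m 1 - bernstein_moment m 2 N)"
proof -
  define h where "h s = (1 + x * s) powr (- \<sigma>) - c * s\<^sup>2" for s
  let ?w = "bernstein_weight m N"
  let ?s = "\<lambda>k. real k / real N"
  have cvxh: "convex_on {0..1} h" using cvx by (simp add: h_def[abs_def])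
  have s01: "?s k \<in> {0..1}" if "k \<le> N" for k using that by (auto simp: divide_le_eq)
  have w1: "(\<Sum>k\<le>N. ?w k) = 1" by (simp add: sum_bernstein_weight m0)
  have mean: "(\<Sum>k\<le>N. ?w k * ?s k) = m 1"
    using bernstein_moment_1[OF N, of m] by (simp add: bernstein_moment_def)
  have split: "(\<Sum>k\<le>N. ?w k * h (?s k)) = bernstein_sum_real m \<sigma> N x - c * bernstein_moment m 2 N"
    unfolding h_def right_diff_distrib sum_subtractf bernstein_sum_real_def bernstein_moment_def
      sum_distrib_left
    by (simp add: mult_ac)
  have "h (\<Sum>k\<le>N. ?w k *\<^sub>R ?s k) \<le> (\<Sum>k\<le>N. ?w k * h (?s k))"
    by (rule convex_on_sum[OF _ _ cvxh]) (use s01 w1 bernstein_weight_nonneg[OF cm] in auto)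
  then have "h (m 1) \<le> bernstein_sum_real m \<sigma> N x - c * bernstein_moment m 2 N"
    by (simp only: split mean real_scaleR_def)
  then show "(1 + x * m 1) powr (- \<sigma>) + c * (bernstein_moment m 2 N - (m 1)\<^sup>2) \<le> bernstein_sum_real m \<sigma> N x"
    by (simp add: h_def algebra_simps)
  have "(\<Sum>k\<le>N. ?w k * h (?s k)) \<le> (\<Sum>k\<le>N. ?w k * ((1 - ?s k) * h 0 + ?s k * h 1))"
  proof (rule sum_mono)
    fix k assume "k \<in> {..N}"
    then have "h (?s k) \<le> (1 - ?s k) * h 0 + ?s k * h 1"
      using convex_onD[OF cvxh, of "?s k" 0 1] s01[of k] by simp
    then show "?w k * h (?s k) \<le> ?w k * ((1 - ?s k) * h 0 + ?s k * h 1)"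
      using bernstein_weight_nonneg[OF cm] by (intro mult_left_mono)
  qed
  also have "\<dots> = (\<Sum>k\<le>N. ?w k) * h 0 + (\<Sum>k\<le>N. ?w k * ?s k) * (h 1 - h 0)"
  proof -
    have "w * ((1 - t) * u + t * v) = w * u + w * t * (v - u)" for w t u v :: real
      by (simp add: algebra_simps)
    then show ?thesis by (simp only: sum_distrib_right sum.distrib)
  qed
  also have "\<dots> = h 0 + m 1 * (h 1 - h 0)" by (simp only: w1 mean)
  finally have "bernstein_sum_real m \<sigma> N x - c * bernstein_moment m 2 N \<le> h 0 + m 1 * (h 1 - h 0)"
    by (simp only: split)
  then show "bernstein_sum_real m \<sigma> N x \<le> (1 - m 1) + m 1 * (1 + x) powr (- \<sigma>) - c * (m 1 - bernstein_moment m 2 N)"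
    by (simp add: h_def algebra_simps)
qed

text \<open>The Cauchy-Schwarz inequality for \<open>s - m 1\<close> and \<open>s ^ n\<close> under the Bernstein weights. Zero variance means a
  point mass at \<open>m 1\<close>, and so a geometric sequence.\<close>

lemma completely_monotone_variance:
  assumes cm: "completely_monotone m" and m0: "m 0 = 1"
  shows "(m 1)\<^sup>2 \<le> m 2"
    and "m 2 = (m 1)\<^sup>2 \<Longrightarrow> m (Suc n) = m 1 * m n"
proof -
  let ?M = "\<lambda>n N. bernstein_moment m n N"
  have key: "(?M (Suc n) N - m 1 * ?M n N)\<^sup>2 \<le> (?M 2 N - (m 1)\<^sup>2) * ?M (2 * n) N" if N: "N \<ge> 1" for n N
  proof -
    let ?w = "bernstein_weight m N"
    let ?s = "\<lambda>k. real k / real N"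
    let ?r = "\<lambda>k. sqrt (?w k)"
    have w: "sqrt (bernstein_weight m N k) * sqrt (bernstein_weight m N k) = bernstein_weight m N k" for k using bernstein_weight_nonneg[OF cm] by simp
    have w1: "(\<Sum>k\<le>N. ?w k) = 1" by (simp add: sum_bernstein_weight m0)
    have mean: "(\<Sum>k\<le>N. ?w k * ?s k) = m 1"
      using bernstein_moment_1[OF N, of m] by (simp add: bernstein_moment_def)
    have "(\<Sum>k\<le>N. (?r k * (?s k - m 1)) * (?r k * ?s k ^ n))\<^sup>2
       \<le> (\<Sum>k\<le>N. (?r k * (?s k - m 1))\<^sup>2) * (\<Sum>k\<le>N. (?r k * ?s k ^ n)\<^sup>2)"
      by (rule Cauchy_Schwarz_ineq_sum)
    also have "(\<Sum>k\<le>N. (?r k * (?s k - m 1)) * (?r k * ?s k ^ n)) = ?M (Suc n) N - m 1 * ?M n N"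
      unfolding bernstein_moment_def sum_distrib_left sum_subtractf[symmetric]
    proof (intro sum.cong refl)
      fix k
      have "(?r k * (?s k - m 1)) * (?r k * ?s k ^ n) = (?r k * ?r k) * ((?s k - m 1) * ?s k ^ n)"
        by (simp only: mult_ac)
      then show "(?r k * (?s k - m 1)) * (?r k * ?s k ^ n) = ?w k * ?s k ^ Suc n - m 1 * (?w k * ?s k ^ n)"
        unfolding w by (simp add: left_diff_distrib right_diff_distrib mult_ac)
    qed
    also have "(\<Sum>k\<le>N. (?r k * ?s k ^ n)\<^sup>2) = ?M (2 * n) N"
      unfolding bernstein_moment_def
    proof (intro sum.cong refl)
      fix k
      have "(?r k * ?s k ^ n)\<^sup>2 = (?r k * ?r k) * (?s k ^ n * ?s k ^ n)"
        by (simp only: power2_eq_square mult_ac)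
      then show "(?r k * ?s k ^ n)\<^sup>2 = ?w k * ?s k ^ (2 * n)"
        unfolding w by (simp only: mult_2 power_add)
    qed
    also have "(\<Sum>k\<le>N. (?r k * (?s k - m 1))\<^sup>2)
        = (\<Sum>k\<le>N. ?w k * ?s k ^ 2) - 2 * m 1 * (\<Sum>k\<le>N. ?w k * ?s k) + (m 1)\<^sup>2 * (\<Sum>k\<le>N. ?w k)"
      unfolding sum_distrib_left sum_subtractf[symmetric] sum.distrib[symmetric]
    proof (intro sum.cong refl)
      fix k
      have "(?r k * (?s k - m 1))\<^sup>2 = ?w k * (?s k - m 1)\<^sup>2"
        using bernstein_weight_nonneg[OF cm] by (simp add: power_mult_distrib)
      then show "(?r k * (?s k - m 1))\<^sup>2 = ?w k * ?s k ^ 2 - 2 * m 1 * (?w k * ?s k) + (m 1)\<^sup>2 * ?w k"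
        by (simp add: power2_diff algebra_simps)
    qed
    also have "\<dots> = ?M 2 N - (m 1)\<^sup>2"
      unfolding mean w1 by (simp add: bernstein_moment_def power2_eq_square)
    finally show ?thesis .
  qed
  have ev: "\<forall>\<^sub>F N in sequentially. N \<ge> (1::nat)" by (rule eventually_ge_at_top)
  have lim: "(m (Suc n) - m 1 * m n)\<^sup>2 \<le> (m 2 - (m 1)\<^sup>2) * m (2 * n)" for n
  proof (rule tendsto_le)
    show "(\<lambda>N. (?M 2 N - (m 1)\<^sup>2) * ?M (2 * n) N) \<longlonglongrightarrow> (m 2 - (m 1)\<^sup>2) * m (2 * n)"
      by (intro tendsto_intros bernstein_moment_tendsto cm)
    show "(\<lambda>N. (?M (Suc n) N - m 1 * ?M n N)\<^sup>2) \<longlonglongrightarrow> (m (Suc n) - m 1 * m n)\<^sup>2"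
      by (intro tendsto_intros bernstein_moment_tendsto cm)
    show "\<forall>\<^sub>F N in sequentially. (?M (Suc n) N - m 1 * ?M n N)\<^sup>2 \<le> (?M 2 N - (m 1)\<^sup>2) * ?M (2 * n) N"
      using ev by eventually_elim (rule key)
  qed simp
  show "(m 1)\<^sup>2 \<le> m 2" using lim[of 0] m0 by simp
  show "m (Suc n) = m 1 * m n" if "m 2 = (m 1)\<^sup>2"
    using lim[of n] that by simp
qed

text \<open>The differences of \<open>m\<close> are nonnegative and decreasing, so they vanish from the first zero on; the
  measure is then carried by \<open>{0, 1}\<close>.\<close>

lemma completely_monotone_equal_moments:
  assumes cm: "completely_monotone m" and "m 2 = m 1" "n \<ge> 1"
  shows "m n = m 1"
proof -
  have D: "backward_diff m (Suc k) = 0" for k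
  proof (induction k)
    case 0
    then show ?case using assms by (simp add: backward_diff_def numeral_2_eq_2)
  next
    case (Suc k)
    then show ?case
      using completely_monotone_Suc_le[OF completely_monotone_backward_diff[OF cm], of "Suc k"]
        completely_monotone_nonneg[OF completely_monotone_backward_diff[OF cm], of "Suc (Suc k)"]
      by simp
  qed
  show ?thesis using \<open>n \<ge> 1\<close>
  proof (induction n rule: dec_induct)
    case (step n)
    then show ?case using D[of "n - 1"] by (simp add: backward_diff_def)
  qed simp
qed

text \<open>In the limit the margins become \<open>c * (m 2 - (m 1)\<^sup>2)\<close> and \<open>c * (m 1 - m 2)\<close>, which are positive; hence the
  strict inequalities.\<close>

lemma hyp_F_bounds:
  assumes cm: "completely_monotone m" and \<sigma>: "\<sigma> > 0"
    and m: "\<And>n. m n = (\<Prod>i=1..q. pochhammer (a i) n) / (\<Prod>i=1..q. pochhammer (b i) n)"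
    and var: "m 2 \<noteq> (m 1)\<^sup>2" and bern: "m 2 \<noteq> m 1"
    and x: "x > -1" "x \<noteq> 0"
  shows "hyp_F q \<sigma> a b (of_real (- x)) \<in> \<real> \<and>
         (1 + x * m 1) powr (- \<sigma>) < Re (hyp_F q \<sigma> a b (of_real (- x))) \<and>
         Re (hyp_F q \<sigma> a b (of_real (- x))) < (1 - m 1) + m 1 * (1 + x) powr (- \<sigma>)"
proof -
  have m0: "m 0 = 1" by (simp add: m)
  obtain c where c: "c > 0" "convex_on {0..1} (\<lambda>s. (1 + x * s) powr (- \<sigma>) - c * s\<^sup>2)"
    using stieltjes_kernel_strongly_convex[OF \<sigma> x] by blast
  obtain r where r: "strict_mono (r :: nat \<Rightarrow> nat)"
    and lim: "\<And>y. y \<in> UNIV - complex_of_real ` {1..} \<Longrightarrow> (\<lambda>N. bernstein_sum m \<sigma> (r N) y) \<longlonglongrightarrow> hyp_F q \<sigma> a b y"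
    using hyp_F_eq_lim_bernstein_sum[OF cm \<sigma> m] by blast
  define F where "F = hyp_F q \<sigma> a b (of_real (- x))"
  have "complex_of_real (- x) \<in> UNIV - complex_of_real ` {1..}"
    using x by (auto simp del: of_real_minus)
  from lim[OF this] have lim': "(\<lambda>N. complex_of_real (bernstein_sum_real m \<sigma> (r N) x)) \<longlonglongrightarrow> F"
    unfolding F_def bernstein_sum_of_real[OF x(1)] .
  have real: "F \<in> \<real>"
    by (rule closed_sequentially[OF closed_complex_Reals _ lim']) auto
  have limR: "(\<lambda>N. bernstein_sum_real m \<sigma> (r N) x) \<longlonglongrightarrow> Re F"
    using tendsto_Re[OF lim'] by simp
  have ev: "\<forall>\<^sub>F N in sequentially. r N \<ge> 1"
    using eventually_ge_at_top[of 1] by eventually_elim (use seq_suble[OF r] order_trans in blast)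
  have mom: "(\<lambda>N. bernstein_moment m 2 (r N)) \<longlonglongrightarrow> m 2"
    using LIMSEQ_subseq_LIMSEQ[OF bernstein_moment_tendsto[OF cm] r] by (simp add: o_def)
  have "(1 + x * m 1) powr (- \<sigma>) + c * (m 2 - (m 1)\<^sup>2) \<le> Re F"
  proof (rule tendsto_le[OF _ limR])
    show "(\<lambda>N. (1 + x * m 1) powr (- \<sigma>) + c * (bernstein_moment m 2 (r N) - (m 1)\<^sup>2))
       \<longlonglongrightarrow> (1 + x * m 1) powr (- \<sigma>) + c * (m 2 - (m 1)\<^sup>2)"
      by (intro tendsto_intros mom)
    show "\<forall>\<^sub>F N in sequentially. (1 + x * m 1) powr (- \<sigma>) + c * (bernstein_moment m 2 (r N) - (m 1)\<^sup>2)
        \<le> bernstein_sum_real m \<sigma> (r N) x"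
      using ev by eventually_elim (rule bernstein_sum_real_bounds(1)[OF cm m0 _ c(2) x(1)])
  qed simp
  moreover have "c * (m 2 - (m 1)\<^sup>2) > 0"
    using c(1) var completely_monotone_variance(1)[OF cm m0] by simp
  moreover have "Re F \<le> (1 - m 1) + m 1 * (1 + x) powr (- \<sigma>) - c * (m 1 - m 2)"
  proof (rule tendsto_le[OF _ _ limR])
    show "(\<lambda>N. (1 - m 1) + m 1 * (1 + x) powr (- \<sigma>) - c * (m 1 - bernstein_moment m 2 (r N)))
       \<longlonglongrightarrow> (1 - m 1) + m 1 * (1 + x) powr (- \<sigma>) - c * (m 1 - m 2)"
      by (intro tendsto_intros mom)
    show "\<forall>\<^sub>F N in sequentially. bernstein_sum_real m \<sigma> (r N) x
        \<le> (1 - m 1) + m 1 * (1 + x) powr (- \<sigma>) - c * (m 1 - bernstein_moment m 2 (r N))"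
      using ev by eventually_elim (rule bernstein_sum_real_bounds(2)[OF cm m0 _ c(2) x(1)])
  qed simp
  moreover have "c * (m 1 - m 2) > 0"
    using c(1) bern completely_monotone_Suc_le[OF cm, of 1] by (simp add: numeral_2_eq_2)
  ultimately show ?thesis using real unfolding F_def by linarith
qed

section \<open>Growth of Gamma quotients\<close>

definition polynomial_growth :: "complex set \<Rightarrow> (complex \<Rightarrow> complex) \<Rightarrow> bool" where
  "polynomial_growth A f \<longleftrightarrow> (\<exists>C\<ge>0. \<exists>P. \<forall>z\<in>A. norm (f z) \<le> C * (1 + norm z) ^ P)"

lemma polynomial_growthI:
  assumes "\<And>z. z \<in> A \<Longrightarrow> norm (f z) \<le> C * (1 + norm z) ^ P"
  shows "polynomial_growth A f"
  unfolding polynomial_growth_def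
proof (intro exI[of _ "max 0 C"] conjI exI[of _ P] ballI)
  fix z assume "z \<in> A"
  from assms[OF this] have "norm (f z) \<le> C * (1 + norm z) ^ P" .
  also have "\<dots> \<le> max 0 C * (1 + norm z) ^ P" by (intro mult_right_mono) auto
  finally show "norm (f z) \<le> max 0 C * (1 + norm z) ^ P" .
qed simp

lemma polynomial_growth_bounded:
  "(\<And>z. z \<in> A \<Longrightarrow> norm (f z) \<le> C) \<Longrightarrow> polynomial_growth A f"
  by (rule polynomial_growthI[of A f C 0]) simp

lemma polynomial_growth_subset:
  "polynomial_growth B f \<Longrightarrow> A \<subseteq> B \<Longrightarrow> polynomial_growth A f"
  unfolding polynomial_growth_def by blast

lemma polynomial_growth_mult:
  assumes "polynomial_growth A f" "polynomial_growth A g"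
  shows "polynomial_growth A (\<lambda>z. f z * g z)"
proof -
  from assms obtain C P C' P' where C: "C \<ge> 0" "C' \<ge> 0"
    and f: "\<And>z. z \<in> A \<Longrightarrow> norm (f z) \<le> C * (1 + norm z) ^ P"
    and g: "\<And>z. z \<in> A \<Longrightarrow> norm (g z) \<le> C' * (1 + norm z) ^ P'"
    unfolding polynomial_growth_def by blast
  have "norm (f z * g z) \<le> (C * C') * (1 + norm z) ^ (P + P')" if "z \<in> A" for z
  proof -
    have "norm (f z * g z) \<le> (C * (1 + norm z) ^ P) * (C' * (1 + norm z) ^ P')"
      unfolding norm_mult using C by (intro mult_mono f g that) auto
    then show ?thesis by (simp add: power_add mult_ac)
  qed
  then show ?thesis by (rule polynomial_growthI)
qed

lemma polynomial_growth_prod: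
  assumes "finite I" "\<And>i. i \<in> I \<Longrightarrow> polynomial_growth A (f i)"
  shows "polynomial_growth A (\<lambda>z. \<Prod>i\<in>I. f i z)"
  using assms
proof (induction I rule: finite_induct)
  case empty
  show ?case by (rule polynomial_growth_bounded[of _ _ 1]) simp
next
  case (insert i I)
  then show ?case by (simp add: polynomial_growth_mult)
qed

lemma polynomial_growth_cong:
  assumes "\<And>z. z \<in> A \<Longrightarrow> f z = g z"
  shows "polynomial_growth A f \<longleftrightarrow> polynomial_growth A g"
  unfolding polynomial_growth_def using assms by (simp cong: ball_cong)

lemma polynomial_growth_Un:
  assumes "polynomial_growth A f" "polynomial_growth B f"
  shows "polynomial_growth (A \<union> B) f"
proof -
  from assms obtain C P C' P' where C: "C \<ge> 0" "C' \<ge> 0"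
    and A: "\<And>z. z \<in> A \<Longrightarrow> norm (f z) \<le> C * (1 + norm z) ^ P"
    and B: "\<And>z. z \<in> B \<Longrightarrow> norm (f z) \<le> C' * (1 + norm z) ^ P'"
    unfolding polynomial_growth_def by blast
  have "norm (f z) \<le> (C + C') * (1 + norm z) ^ (P + P')" if "z \<in> A \<union> B" for z
  proof (cases "z \<in> A")
    case True
    have "C * (1 + norm z) ^ P \<le> (C + C') * (1 + norm z) ^ (P + P')"
      using C by (intro mult_mono power_increasing) auto
    then show ?thesis using A[OF True] by simp
  next
    case False
    have "C' * (1 + norm z) ^ P' \<le> (C + C') * (1 + norm z) ^ (P + P')"
      using C by (intro mult_mono power_increasing) auto
    then show ?thesis using B[of z] False that by simp
  qed
  then show ?thesis by (rule polynomial_growthI)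
qed

lemma polynomial_growth_minus:
  "polynomial_growth (uminus ` A) f \<Longrightarrow> polynomial_growth A (\<lambda>z. f (- z))"
  unfolding polynomial_growth_def by auto

lemma polynomial_growth_pochhammer: "polynomial_growth A (\<lambda>z. pochhammer (w + z) n)"
proof -
  have "polynomial_growth A (\<lambda>z. \<Prod>i<n. w + z + of_nat i)"
  proof (rule polynomial_growth_prod)
    fix i
    show "polynomial_growth A (\<lambda>z. w + z + of_nat i)"
    proof (rule polynomial_growthI[of _ _ "norm w + real i + 1" 1])
      fix z
      have "norm (w + z + of_nat i) \<le> norm w + norm z + real i"
        using norm_triangle_ineq[of "w + z" "of_nat i"] norm_triangle_ineq[of w z] by simp
      also have "\<dots> \<le> (norm w + real i + 1) * (1 + norm z) ^ 1"
        by (simp add: algebra_simps add_nonneg_nonneg)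
      finally show "norm (w + z + of_nat i) \<le> (norm w + real i + 1) * (1 + norm z) ^ 1" .
    qed
  qed simp
  then show ?thesis by (simp add: pochhammer_prod lessThan_atLeast0)
qed

lemma of_real_plus_not_nonpos_Ints:
  assumes "(Im z \<noteq> 0) \<or> (Re z > - c)"
  shows "complex_of_real c + z \<notin> \<int>\<^sub>\<le>\<^sub>0"
proof
  assume "complex_of_real c + z \<in> \<int>\<^sub>\<le>\<^sub>0"
  then obtain n where n: "complex_of_real c + z = - of_nat n" by (rule nonpos_Ints_cases')
  from arg_cong[OF n, of Im] arg_cong[OF n, of Re] assms show False by simp
qed

text \<open>The map \<open>c \<mapsto> norm (1 + c * z)\<close> increases on \<open>c \<ge> 0\<close> when \<open>Re z \<ge> 0\<close>; take \<open>c = 1 / B\<close> and \<open>c = 1 / A\<close>.\<close>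

lemma norm_shift_ratio_le:
  assumes "0 < A" "A \<le> B" "Re z \<ge> 0"
  shows "norm (of_real B + z) / norm (of_real A + z) \<le> B / A"
proof -
  have "(A * norm (of_real B + z))\<^sup>2 \<le> (B * norm (of_real A + z))\<^sup>2"
  proof -
    have "0 \<le> 2 * A * B * Re z * (B - A) + (B\<^sup>2 - A\<^sup>2) * ((Re z)\<^sup>2 + (Im z)\<^sup>2)"
      using assms by (intro add_nonneg_nonneg mult_nonneg_nonneg) (auto simp: power_mono)
    also have "\<dots> = B\<^sup>2 * ((A + Re z)\<^sup>2 + (Im z)\<^sup>2) - A\<^sup>2 * ((B + Re z)\<^sup>2 + (Im z)\<^sup>2)"
      by (simp add: power2_eq_square algebra_simps)
    finally show ?thesis by (simp add: power_mult_distrib cmod_power2)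
  qed
  then have "A * norm (of_real B + z) \<le> B * norm (of_real A + z)"
    by (rule power2_le_imp_le) (use assms in simp)
  moreover have "of_real A + z \<noteq> 0" using assms by (auto simp: complex_eq_iff)
  ultimately show ?thesis using assms by (simp add: field_simps)
qed

text \<open>In Euler's product every factor of the quotient is largest in modulus, over the closed right half
  plane, at the origin.\<close>

lemma norm_Gamma_ratio_le:
  assumes "0 < a" "a \<le> b" "Re z \<ge> 0"
  shows "norm (Gamma (of_real a + z) / Gamma (of_real b + z)) \<le> Gamma a / Gamma b"
proof (rule tendsto_le)
  have "Gamma (of_real b + z) \<noteq> 0"
    using of_real_plus_not_nonpos_Ints[of z b] assms by (simp add: Gamma_eq_zero_iff)
  then show "(\<lambda>n. norm (Gamma_series (of_real a + z) n / Gamma_series (of_real b + z) n))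
      \<longlonglongrightarrow> norm (Gamma (of_real a + z) / Gamma (of_real b + z))"
    by (intro tendsto_intros Gamma_series_LIMSEQ)
  have "b > 0" using assms by simp
  then have "Gamma b \<noteq> 0" using Gamma_real_pos by (metis less_irrefl)
  then show "(\<lambda>n. Gamma_series a n / Gamma_series b n) \<longlonglongrightarrow> Gamma a / Gamma b"
    by (intro tendsto_intros Gamma_series_LIMSEQ)
  show "\<forall>\<^sub>F n in sequentially. norm (Gamma_series (of_real a + z) n / Gamma_series (of_real b + z) n)
      \<le> Gamma_series a n / Gamma_series b n"
  proof (rule always_eventually, rule allI)
    fix n :: nat
    define L where "L = ln (real n)"
    have poch: "pochhammer w (n + 1) = (\<Prod>i<n+1. w + of_nat i)" for w :: "'a::comm_semiring_1"
      by (simp add: pochhammer_prod lessThan_atLeast0)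
    have "norm (Gamma_series (of_real a + z) n / Gamma_series (of_real b + z) n)
        = exp (a * L) / exp (b * L)
          * (norm (pochhammer (of_real b + z) (n + 1)) / norm (pochhammer (of_real a + z) (n + 1)))"
      by (simp add: Gamma_series_def norm_mult norm_divide norm_exp_eq_Re L_def[symmetric] exp_add distrib_right field_simps)
    also have "norm (pochhammer (of_real b + z) (n + 1)) / norm (pochhammer (of_real a + z) (n + 1))
        = (\<Prod>i<n+1. norm (of_real (b + real i) + z) / norm (of_real (a + real i) + z))"
      unfolding poch prod_norm[symmetric] prod_dividef[symmetric] by (intro prod.cong refl) (simp add: add_ac)
    also have "exp (a * L) / exp (b * L) * \<dots> \<le> exp (a * L) / exp (b * L) * (\<Prod>i<n+1. (b + real i) / (a + real i))"
      using assms by (intro mult_left_mono prod_mono conjI norm_shift_ratio_le) auto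
    also have "\<dots> = Gamma_series a n / Gamma_series b n"
      unfolding prod_dividef poch[symmetric] Gamma_series_def L_def by (simp add: field_simps)
    finally show "norm (Gamma_series (of_real a + z) n / Gamma_series (of_real b + z) n)
      \<le> Gamma_series a n / Gamma_series b n" .
  qed
qed simp

text \<open>Raising \<open>b\<close> by an integer until it exceeds \<open>a\<close> costs only a polynomial factor.\<close>

lemma polynomial_growth_Gamma_ratio_right:
  assumes "0 < a" "0 < b"
  shows "polynomial_growth {z. Re z \<ge> 0} (\<lambda>z. Gamma (of_real a + z) / Gamma (of_real b + z))"
proof -
  obtain N where N: "a \<le> b + real N" using real_arch_simple[of "a - b"] by (auto simp: algebra_simps)
  have "polynomial_growth {z. Re z \<ge> 0}
      (\<lambda>z. (Gamma (of_real a + z) / Gamma (of_real (b + real N) + z)) * pochhammer (of_real b + z) N)"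
    by (intro polynomial_growth_mult polynomial_growth_pochhammer
        polynomial_growth_bounded[OF norm_Gamma_ratio_le[OF assms(1) N]]) auto
  moreover have "(Gamma (of_real a + z) / Gamma (of_real (b + real N) + z)) * pochhammer (of_real b + z) N
      = Gamma (of_real a + z) / Gamma (of_real b + z)" if "Re z \<ge> 0" for z
  proof -
    have "of_real b + z \<notin> \<int>\<^sub>\<le>\<^sub>0" "of_real (b + real N) + z \<notin> \<int>\<^sub>\<le>\<^sub>0"
      using that assms by (intro of_real_plus_not_nonpos_Ints; simp)+
    moreover have "of_real b + z + of_nat N = of_real (b + real N) + z" by simp
    moreover have "pochhammer (of_real b + z) N = Gamma (of_real b + z + of_nat N) / Gamma (of_real b + z)"
      by (rule pochhammer_Gamma) fact
    moreover have "u / w * (w / v) = u / v" if "w \<noteq> 0" for u v w :: complex using that by simp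
    ultimately show ?thesis by (simp only: Gamma_eq_zero_iff not_False_eq_True)
  qed
  ultimately show ?thesis by (subst (asm) polynomial_growth_cong) auto
qed

text \<open>The square of \<open>norm (sin (u + \<i> * v))\<close> differs from \<open>(exp (2 * v) + exp (- 2 * v)) / 4\<close> by at most \<open>1 / 2\<close>,
  whatever the real part is.\<close>

lemma norm_sin_ratio_le:
  assumes "\<bar>Im z\<bar> \<ge> 1"
  shows "norm (sin (of_real pi * (of_real b + z)) / sin (of_real pi * (of_real a + z))) \<le> 2"
proof -
  define v where "v = pi * Im z"
  define E where "E = exp (2 * v) + inverse (exp (2 * v))"
  have "\<bar>2 * v\<bar> \<ge> 6"
  proof -
    have "\<bar>2 * v\<bar> = 2 * pi * \<bar>Im z\<bar>" by (simp add: v_def abs_mult)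
    also have "\<dots> \<ge> 2 * 3 * 1" using assms pi_gt3 by (intro mult_mono) auto
    finally show ?thesis by simp
  qed
  moreover have "E \<ge> exp \<bar>2 * v\<bar>"
    by (cases "v \<ge> 0") (auto simp: E_def exp_minus)
  ultimately have E: "E \<ge> 6" using exp_ge_add_one_self[of "\<bar>2 * v\<bar>"] by linarith
  have sq: "(norm (sin (of_real pi * (of_real c + z))))\<^sup>2 = (E - 2 * cos (2 * (pi * (c + Re z)))) / 4" for c
    unfolding norm_sin_squared by (simp add: E_def v_def)
  have up: "(norm (sin (of_real pi * (of_real b + z))))\<^sup>2 \<le> (E + 2) / 4"
    unfolding sq by (intro divide_right_mono) (use cos_ge_minus_one in \<open>auto simp: minus_le_iff\<close>)
  have lo: "(norm (sin (of_real pi * (of_real a + z))))\<^sup>2 \<ge> (E - 2) / 4"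
    unfolding sq by (intro divide_right_mono) auto
  have "(norm (sin (of_real pi * (of_real b + z))))\<^sup>2 \<le> (2 * norm (sin (of_real pi * (of_real a + z))))\<^sup>2"
    using up lo E by (simp add: power_mult_distrib)
  then have "norm (sin (of_real pi * (of_real b + z))) \<le> 2 * norm (sin (of_real pi * (of_real a + z)))"
    by (rule power2_le_imp_le) simp
  moreover have "norm (sin (of_real pi * (of_real a + z))) > 0"
  proof (rule ccontr)
    assume "\<not> ?thesis"
    then have "norm (sin (of_real pi * (of_real a + z))) = 0" by simp
    then show False using lo E by simp
  qed
  ultimately show ?thesis by (simp add: norm_divide divide_le_eq)
qed

text \<open>To the left, the reflection formula exchanges the quotient for one on the right half plane; the
  sines it brings in are comparable off the strip.\<close>

lemma polynomial_growth_Gamma_ratio_left: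
  "polynomial_growth {z. Re z \<le> 0 \<and> \<bar>Im z\<bar> \<ge> 1} (\<lambda>z. Gamma (of_real a + z) / Gamma (of_real b + z))"
proof -
  let ?A = "{z. Re z \<le> 0 \<and> \<bar>Im z\<bar> \<ge> 1}"
  obtain N where N: "max a b \<le> real N" using real_arch_simple by blast
  define a' b' where "a' = 1 - a + real N" and "b' = 1 - b + real N"
  have pos: "a' > 0" "b' > 0" using N by (auto simp: a'_def b'_def)
  have gr: "polynomial_growth ?A (\<lambda>z. Gamma (of_real b' + - z) / Gamma (of_real a' + - z))"
  proof (rule polynomial_growth_minus)
    show "polynomial_growth (uminus ` ?A) (\<lambda>z. Gamma (of_real b' + z) / Gamma (of_real a' + z))"
      by (rule polynomial_growth_subset[OF polynomial_growth_Gamma_ratio_right[OF pos(2,1)]]) auto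
  qed
  have gp: "polynomial_growth ?A (\<lambda>z. pochhammer (of_real (1 - a) + - z) N)"
    by (rule polynomial_growth_minus[OF polynomial_growth_pochhammer])
  have gi: "polynomial_growth ?A (\<lambda>z. 1 / pochhammer (of_real (1 - b) + - z) N)"
  proof (rule polynomial_growth_bounded[of _ _ 1])
    fix z assume z: "z \<in> ?A"
    have "1 = (\<Prod>i<N. 1 :: real)" by simp
    also have "\<dots> \<le> (\<Prod>i<N. norm (of_real (1 - b) + - z + of_nat i))"
    proof (rule prod_mono, safe)
      fix i
      have "1 \<le> \<bar>Im (of_real (1 - b) + - z + of_nat i)\<bar>" using z by simp
      also have "\<dots> \<le> norm (of_real (1 - b) + - z + of_nat i)" by (rule abs_Im_le_cmod)
      finally show "1 \<le> norm (of_real (1 - b) + - z + of_nat i)" .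
    qed simp
    finally show "norm (1 / pochhammer (of_real (1 - b) + - z) N) \<le> 1"
      by (simp add: pochhammer_prod lessThan_atLeast0 norm_divide prod_norm divide_le_eq)
  qed
  have gs: "polynomial_growth ?A (\<lambda>z. sin (of_real pi * (of_real b + z)) / sin (of_real pi * (of_real a + z)))"
    by (rule polynomial_growth_bounded[OF norm_sin_ratio_le]) simp
  have eq: "Gamma (of_real b' + - z) / Gamma (of_real a' + - z) * pochhammer (of_real (1 - a) + - z) N
       * (1 / pochhammer (of_real (1 - b) + - z) N)
       * (sin (of_real pi * (of_real b + z)) / sin (of_real pi * (of_real a + z)))
     = Gamma (of_real a + z) / Gamma (of_real b + z)" if z: "z \<in> ?A" for z
  proof -
    have im: "Im z \<noteq> 0" "Im (- z) \<noteq> 0" using z by auto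
    have shift: "Gamma (of_real (1 - c + real N) + - z)
        = pochhammer (of_real (1 - c) + - z) N * Gamma (of_real (1 - c) + - z)" for c
    proof -
      have ni: "of_real (1 - c) + - z \<notin> \<int>\<^sub>\<le>\<^sub>0" using im by (intro of_real_plus_not_nonpos_Ints) auto
      have "of_real (1 - c) + - z + of_nat N = of_real (1 - c + real N) + - z" by simp
      with pochhammer_Gamma[OF ni, of N] ni show ?thesis by (simp only: Gamma_eq_zero_iff) (simp add: Gamma_eq_zero_iff)
    qed
    have refl: "Gamma (of_real c + z) = of_real pi / (sin (of_real pi * (of_real c + z)) * Gamma (of_real (1 - c) + - z))"
      and nz: "Gamma (of_real (1 - c) + - z) \<noteq> 0" "pochhammer (of_real (1 - c) + - z) N \<noteq> 0"
        "sin (of_real pi * (of_real c + z)) \<noteq> 0" for c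
    proof -
      have ni: "of_real (1 - c) + - z \<notin> \<int>\<^sub>\<le>\<^sub>0" "of_real c + z \<notin> \<int>\<^sub>\<le>\<^sub>0" "of_real (1 - c + real N) + - z \<notin> \<int>\<^sub>\<le>\<^sub>0"
        using im by (intro of_real_plus_not_nonpos_Ints; simp)+
      then show nz1: "Gamma (of_real (1 - c) + - z) \<noteq> 0" by (simp add: Gamma_eq_zero_iff)
      have "Gamma (of_real (1 - c + real N) + - z) \<noteq> 0" using ni by (simp add: Gamma_eq_zero_iff)
      then show "pochhammer (of_real (1 - c) + - z) N \<noteq> 0" unfolding shift by auto
      have "1 - (of_real c + z) = of_real (1 - c) + - z" by simp
      with Gamma_reflection_complex[of "of_real c + z"]
      have r: "Gamma (of_real c + z) * Gamma (of_real (1 - c) + - z) = of_real pi / sin (of_real pi * (of_real c + z))"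
        by simp
      moreover have "Gamma (of_real c + z) \<noteq> 0" using ni by (simp add: Gamma_eq_zero_iff)
      ultimately show "sin (of_real pi * (of_real c + z)) \<noteq> 0" using nz1 by auto
      show "Gamma (of_real c + z) = of_real pi / (sin (of_real pi * (of_real c + z)) * Gamma (of_real (1 - c) + - z))"
      proof -
        have "u = w / (v * t)" if "u * t = w / v" "t \<noteq> 0" for u v w t :: complex
          using that by (metis divide_divide_eq_left nonzero_mult_div_cancel_right)
        from this[OF r nz1] show ?thesis .
      qed
    qed
    show ?thesis
      unfolding a'_def b'_def shift refl[of a] refl[of b]
      using nz[of a] nz[of b] by (simp add: divide_simps)
  qed
  have "polynomial_growth ?A (\<lambda>z. Gamma (of_real b' + - z) / Gamma (of_real a' + - z) * pochhammer (of_real (1 - a) + - z) N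
       * (1 / pochhammer (of_real (1 - b) + - z) N)
       * (sin (of_real pi * (of_real b + z)) / sin (of_real pi * (of_real a + z))))"
    by (intro polynomial_growth_mult gr gp gi gs)
  then show ?thesis using eq by (subst (asm) polynomial_growth_cong) auto
qed

lemma polynomial_growth_Gamma_quotient:
  assumes "\<And>i. i \<in> {1..q::nat} \<Longrightarrow> a i > 0" "\<And>i. i \<in> {1..q} \<Longrightarrow> b i > 0"
  shows "polynomial_growth {z. Re z \<ge> 0 \<or> \<bar>Im z\<bar> \<ge> 1}
    (\<lambda>z. (\<Prod>i=1..q. Gamma (of_real (a i) + z)) / (\<Prod>i=1..q. Gamma (of_real (b i) + z)))"
proof -
  have "polynomial_growth ({z. Re z \<ge> 0} \<union> {z. Re z \<le> 0 \<and> \<bar>Im z\<bar> \<ge> 1})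
      (\<lambda>z. \<Prod>i=1..q. Gamma (of_real (a i) + z) / Gamma (of_real (b i) + z))"
    by (intro polynomial_growth_prod polynomial_growth_Un polynomial_growth_Gamma_ratio_right
        polynomial_growth_Gamma_ratio_left assms) auto
  moreover have "{z. Re z \<ge> 0} \<union> {z. Re z \<le> 0 \<and> \<bar>Im z\<bar> \<ge> 1} = {z. Re z \<ge> 0 \<or> \<bar>Im z\<bar> \<ge> 1}" by auto
  ultimately show ?thesis by (simp add: prod_dividef)
qed

text \<open>By Euler's product the quotient is asymptotic to a constant times \<open>n\<close> to the power
  \<open>(\<Sum> a i) - (\<Sum> b i)\<close>.\<close>

lemma bounded_pochhammer_quotient:
  fixes a b :: "nat \<Rightarrow> real"
  assumes a: "\<And>i. i \<in> {1..q::nat} \<Longrightarrow> a i > 0" and b: "\<And>i. i \<in> {1..q} \<Longrightarrow> b i > 0"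
    and le: "(\<Sum>i=1..q. a i) \<le> (\<Sum>i=1..q. b i)"
  shows "\<exists>B. \<forall>n. \<bar>(\<Prod>i=1..q. pochhammer (a i) n) / (\<Prod>i=1..q. pochhammer (b i) n)\<bar> \<le> B"
proof -
  let ?m = "\<lambda>n. (\<Prod>i=1..q. pochhammer (a i) n) / (\<Prod>i=1..q. pochhammer (b i) n)"
  let ?g = "\<lambda>n. \<Prod>i=1..q. Gamma_series (b i) n / Gamma_series (a i) n"
  have "?g \<longlonglongrightarrow> (\<Prod>i=1..q. Gamma (b i) / Gamma (a i))"
  proof (intro tendsto_prod tendsto_divide Gamma_series_LIMSEQ)
    fix i assume "i \<in> {1..q}"
    then show "Gamma (a i) \<noteq> 0" using Gamma_real_pos[OF a] by (metis less_irrefl)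
  qed
  then have "Bseq ?g" by (simp add: convergent_imp_Bseq convergentI)
  then obtain B where B: "\<And>n. \<bar>?g n\<bar> \<le> B" by (auto simp: Bseq_def)
  have "\<bar>?m (Suc n)\<bar> \<le> B" if "n \<ge> 1" for n
  proof -
    \<comment> \<open>The Gamma series at n involves the Pochhammer symbol of order n + 1, hence the index shift.\<close>
    define L where "L = ln (real n)"
    have "L \<ge> 0" using that by (simp add: L_def)
    have "?m (Suc n) = (\<Prod>i=1..q. exp ((a i - b i) * L) * (Gamma_series (b i) n / Gamma_series (a i) n))"
      unfolding prod_dividef[symmetric]
      by (intro prod.cong) (auto simp: Gamma_series_def L_def left_diff_distrib exp_diff)
    also have "\<dots> = exp (((\<Sum>i=1..q. a i) - (\<Sum>i=1..q. b i)) * L) * ?g n"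
      unfolding prod.distrib by (simp add: sum_distrib_right sum_subtractf left_diff_distrib flip: exp_sum)
    finally have "\<bar>?m (Suc n)\<bar> = exp (((\<Sum>i=1..q. a i) - (\<Sum>i=1..q. b i)) * L) * \<bar>?g n\<bar>"
      by (simp add: abs_mult)
    also have "\<dots> \<le> 1 * B"
      using le \<open>L \<ge> 0\<close> B by (intro mult_mono) (auto simp: mult_nonpos_nonneg)
    finally show ?thesis by simp
  qed
  then have tail: "\<bar>?m n\<bar> \<le> B" if "n \<ge> 2" for n
    using that by (cases n) auto
  have "\<bar>?m n\<bar> \<le> max B (max \<bar>?m 0\<bar> \<bar>?m 1\<bar>)" for n
  proof (cases "n \<ge> 2")
    case True
    then show ?thesis using tail[OF True] by linarith
  next
    case False
    then have "n = 0 \<or> n = 1" by auto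
    then show ?thesis by auto
  qed
  then show ?thesis by blast
qed

lemma pochhammer_quotient_Suc:
  "(\<Prod>i=1..q. pochhammer (a i) (Suc n)) / (\<Prod>i=1..q. pochhammer (b i :: real) (Suc n))
   = (\<Prod>i=1..q. (a i + real n) / (b i + real n))
     * ((\<Prod>i=1..q. pochhammer (a i) n) / (\<Prod>i=1..q. pochhammer (b i) n))"
  by (simp add: pochhammer_Suc prod.distrib prod_dividef mult.commute)

lemma pochhammer_quotient_ratio_tendsto:
  "(\<lambda>n. \<Prod>i=1..q. (a i + real n) / (b i + real n)) \<longlonglongrightarrow> 1"
proof -
  have "(\<lambda>n. (\<alpha> + real n) / (\<beta> + real n)) \<longlonglongrightarrow> 1" for \<alpha> \<beta> by real_asymp
  then have "(\<lambda>n. \<Prod>i=1..q. (a i + real n) / (b i + real n)) \<longlonglongrightarrow> (\<Prod>i=1..q. 1)"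
    by (intro tendsto_prod)
  then show ?thesis by simp
qed

section \<open>Integrals over the left loop\<close>

text \<open>The union of all the truncated loops, so that continuity can be stated once for every \<open>R\<close>.\<close>

definition loop_region :: "complex set" where
  "loop_region = {z. Re z \<le> 0 \<and> (\<bar>Im z\<bar> = 1 \<or> (Re z = 0 \<and> \<bar>Im z\<bar> \<le> 1))}"

lemma horizontal_segmentD:
  "z \<in> closed_segment (Complex r v) (Complex r' v) \<Longrightarrow> Im z = v \<and> min r r' \<le> Re z \<and> Re z \<le> max r r'"
  by (auto simp: closed_segment_same_Im closed_segment_eq_real_ivl split: if_splits)

lemma vertical_segmentD:
  "z \<in> closed_segment (Complex r v) (Complex r v') \<Longrightarrow> Re z = r \<and> min v v' \<le> Im z \<and> Im z \<le> max v v'"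
  by (auto simp: closed_segment_same_Re closed_segment_eq_real_ivl split: if_splits)

lemma loop_segments:
  assumes "R \<ge> 0"
  shows "closed_segment (Complex (- R) (- 1)) (Complex 0 (- 1)) \<subseteq> loop_region"
    "closed_segment (Complex 0 (- 1)) (Complex 0 1) \<subseteq> loop_region"
    "closed_segment (Complex 0 1) (Complex (- R) 1) \<subseteq> loop_region"
  using assms
  by (auto simp: loop_region_def dest!: horizontal_segmentD vertical_segmentD)

lemma path_image_left_loop: "R \<ge> 0 \<Longrightarrow> path_image (left_loop R) \<subseteq> loop_region"
  using loop_segments[of R] by (auto simp: left_loop_def path_image_join)

lemma contour_integral_left_loop:
  assumes "continuous_on loop_region f" "R \<ge> 0"
  shows "f contour_integrable_on left_loop R"
    "contour_integral (left_loop R) f =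
      contour_integral (linepath (Complex (- R) (- 1)) (Complex 0 (- 1))) f
      + contour_integral (linepath (Complex 0 (- 1)) (Complex 0 1)) f
      + contour_integral (linepath (Complex 0 1) (Complex (- R) 1)) f"
proof -
  have int: "f contour_integrable_on linepath (Complex (- R) (- 1)) (Complex 0 (- 1))"
    "f contour_integrable_on linepath (Complex 0 (- 1)) (Complex 0 1)"
    "f contour_integrable_on linepath (Complex 0 1) (Complex (- R) 1)"
    by (intro contour_integrable_continuous_linepath continuous_on_subset[OF assms(1)] loop_segments[OF assms(2)])+
  then show "f contour_integrable_on left_loop R"
    unfolding left_loop_def by (intro contour_integrable_joinI valid_path_join) auto
  show "contour_integral (left_loop R) f =
      contour_integral (linepath (Complex (- R) (- 1)) (Complex 0 (- 1))) f
      + contour_integral (linepath (Complex 0 (- 1)) (Complex 0 1)) f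
      + contour_integral (linepath (Complex 0 1) (Complex (- R) 1)) f"
    using int unfolding left_loop_def
    by (subst contour_integral_join) (auto intro!: contour_integrable_joinI)
qed

lemma contour_integral_linepath:
  "contour_integral (linepath a b) f = integral {0..1} (\<lambda>x. f (linepath a b x) * (b - a))"
  by (simp add: contour_integral_integral)

lemma contour_integral_linepath_param_continuous:
  assumes "continuous_on (closed_segment a b \<times> U) (\<lambda>(s, z). f s z)"
  shows "continuous_on U (\<lambda>z. contour_integral (linepath a b) (\<lambda>s. f s z))"
proof -
  have "continuous_on (U \<times> cbox 0 1) (\<lambda>p. (case (linepath a b (snd p), fst p) of (s, z) \<Rightarrow> f s z) * (b - a))"
    by (intro continuous_intros continuous_on_compose2[OF assms] continuous_on_compose2[OF continuous_on_linepath])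
       (auto simp: linepath_in_path)
  then have "continuous_on U (\<lambda>z. integral (cbox 0 1) (\<lambda>x. f (linepath a b x) z * (b - a)))"
    by (intro integral_continuous_on_param) (simp add: split_beta)
  then show ?thesis by (simp add: contour_integral_linepath cbox_interval)
qed

text \<open>The corners of the loop make its derivative discontinuous, so Fubini's theorem is applied to each of the
  three segments.\<close>

lemma contour_integral_left_loop_swap:
  assumes cont: "continuous_on (closed_segment a b \<times> loop_region) (\<lambda>(s, z). f s z)" and R: "R \<ge> 0"
  shows "(\<lambda>s. contour_integral (left_loop R) (f s)) contour_integrable_on linepath a b"
    "contour_integral (linepath a b) (\<lambda>s. contour_integral (left_loop R) (f s))
      = contour_integral (left_loop R) (\<lambda>z. contour_integral (linepath a b) (\<lambda>s. f s z))"
proof -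
  have fs: "continuous_on loop_region (f s)" if "s \<in> closed_segment a b" for s
  proof -
    have "continuous_on loop_region (\<lambda>z. case (s, z) of (s, z) \<Rightarrow> f s z)"
      by (rule continuous_on_compose2[OF cont]) (use that in \<open>auto intro!: continuous_intros\<close>)
    then show ?thesis by simp
  qed
  define ci where "ci c d s = contour_integral (linepath c d) (f s)" for c d s
  have eq: "contour_integral (left_loop R) (f s) = ci (Complex (- R) (- 1)) (Complex 0 (- 1)) s
      + ci (Complex 0 (- 1)) (Complex 0 1) s + ci (Complex 0 1) (Complex (- R) 1) s"
    if "s \<in> closed_segment a b" for s
    unfolding ci_def by (rule contour_integral_left_loop(2)[OF fs[OF that] R])
  have sub: "continuous_on (closed_segment a b \<times> closed_segment c d) (\<lambda>(s, z). f s z)"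
    if "closed_segment c d \<subseteq> loop_region" for c d
    by (rule continuous_on_subset[OF cont]) (use that in auto)
  have int: "ci c d contour_integrable_on linepath a b" if "closed_segment c d \<subseteq> loop_region" for c d
  proof (rule contour_integrable_continuous_linepath)
    have "continuous_on (closed_segment c d \<times> closed_segment a b) (\<lambda>p. case (snd p, fst p) of (s, z) \<Rightarrow> f s z)"
      by (rule continuous_on_compose2[OF sub[OF that]]) (auto intro!: continuous_intros)
    then show "continuous_on (closed_segment a b) (ci c d)"
      unfolding ci_def
      by (intro contour_integral_linepath_param_continuous[of c d "closed_segment a b" "\<lambda>z s. f s z"])
         (simp add: split_beta)
  qed
  have swap: "contour_integral (linepath a b) (ci c d) = contour_integral (linepath c d) (\<lambda>z. contour_integral (linepath a b) (\<lambda>s. f s z))"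
    if "closed_segment c d \<subseteq> loop_region" for c d
    unfolding ci_def by (rule contour_integral_swap) (use sub[OF that] in auto)
  have sum: "(\<lambda>s. ci (Complex (- R) (- 1)) (Complex 0 (- 1)) s
      + ci (Complex 0 (- 1)) (Complex 0 1) s + ci (Complex 0 1) (Complex (- R) 1) s) contour_integrable_on linepath a b"
    by (intro contour_integrable_add int loop_segments[OF R])
  then show "(\<lambda>s. contour_integral (left_loop R) (f s)) contour_integrable_on linepath a b"
    by (rule contour_integrable_eq) (simp add: eq)
  have "contour_integral (linepath a b) (\<lambda>s. contour_integral (left_loop R) (f s))
      = contour_integral (linepath a b) (\<lambda>s. ci (Complex (- R) (- 1)) (Complex 0 (- 1)) s
      + ci (Complex 0 (- 1)) (Complex 0 1) s + ci (Complex 0 1) (Complex (- R) 1) s)"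
    by (rule contour_integral_eq) (simp add: eq)
  also have "\<dots> = contour_integral (linepath a b) (ci (Complex (- R) (- 1)) (Complex 0 (- 1)))
      + contour_integral (linepath a b) (ci (Complex 0 (- 1)) (Complex 0 1))
      + contour_integral (linepath a b) (ci (Complex 0 1) (Complex (- R) 1))"
    using loop_segments[OF R] by (simp add: contour_integral_add int contour_integrable_add)
  also have "\<dots> = contour_integral (left_loop R) (\<lambda>z. contour_integral (linepath a b) (\<lambda>s. f s z))"
    using loop_segments[OF R]
    by (subst contour_integral_left_loop(2)[OF contour_integral_linepath_param_continuous[OF cont] R])
       (simp add: swap)
  finally show "contour_integral (linepath a b) (\<lambda>s. contour_integral (left_loop R) (f s))
      = contour_integral (left_loop R) (\<lambda>z. contour_integral (linepath a b) (\<lambda>s. f s z))" .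
qed

text \<open>The legs become arbitrarily long, so length times maximum is useless here; instead \<open>M / r\<^sup>2\<close> is
  integrated along the leg.\<close>

lemma norm_contour_integral_leg_le:
  assumes R: "1 \<le> R" "R \<le> R'"
    and cont: "continuous_on (closed_segment (Complex (- R') v) (Complex (- R) v)) f"
    and bound: "\<And>r. R \<le> r \<Longrightarrow> norm (f (Complex (- r) v)) \<le> M / r\<^sup>2"
    and M: "M \<ge> 0"
  shows "norm (contour_integral (linepath (Complex (- R') v) (Complex (- R) v)) f) \<le> M / R"
proof (cases "R = R'")
  case True
  then show ?thesis using R M by simp
next
  case False
  then have lt: "R < R'" using R by simp
  let ?g = "\<lambda>z. f (z + \<i> * of_real v)"
  have shift: "linepath (complex_of_real (- R')) (of_real (- R)) x + \<i> * of_real v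
      = linepath (Complex (- R') v) (Complex (- R) v) x" for x
    by (simp add: linepath_def complex_eq_iff algebra_simps)
  have "contour_integral (linepath (Complex (- R') v) (Complex (- R) v)) f
      = contour_integral (linepath (of_real (- R')) (of_real (- R))) ?g"
    unfolding contour_integral_linepath shift by (simp add: Complex_eq)
  also have "\<dots> = integral {- R'..- R} (\<lambda>x. ?g (of_real x))"
    by (subst contour_integral_linepath_Reals_eq) (use lt in auto)
  finally have eq: "contour_integral (linepath (Complex (- R') v) (Complex (- R) v)) f
      = integral {- R'..- R} (\<lambda>x. ?g (of_real x))" .
  have I: "((\<lambda>x. M / x\<^sup>2) has_integral (- M / (- R)) - (- M / (- R'))) {- R'..- R}"
  proof (rule fundamental_theorem_of_calculus)
    fix x assume "x \<in> {- R'..- R}"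
    then have "x \<noteq> 0" using R by auto
    then have "((\<lambda>x. - M / x) has_real_derivative M / x\<^sup>2) (at x within {- R'..- R})"
      by (auto intro!: derivative_eq_intros simp: power2_eq_square)
    then show "((\<lambda>x. - M / x) has_vector_derivative M / x\<^sup>2) (at x within {- R'..- R})"
      by (simp add: has_real_derivative_iff_has_vector_derivative)
  qed (use R in auto)
  have "continuous_on {- R'..- R} (\<lambda>x. ?g (of_real x))"
  proof (rule continuous_on_compose2[OF cont])
    show "(\<lambda>x. complex_of_real x + \<i> * of_real v) ` {- R'..- R} \<subseteq> closed_segment (Complex (- R') v) (Complex (- R) v)"
      using lt by (auto simp: closed_segment_same_Im closed_segment_eq_real_ivl)
  qed (intro continuous_intros)
  then have "norm (integral {- R'..- R} (\<lambda>x. ?g (of_real x))) \<le> integral {- R'..- R} (\<lambda>x. M / x\<^sup>2)"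
  proof (intro integral_norm_bound_integral[OF integrable_continuous_interval has_integral_integrable[OF I]])
    fix x assume "x \<in> {- R'..- R}"
    moreover have "of_real x + \<i> * of_real v = Complex (- (- x)) v" by (simp add: complex_eq_iff)
    ultimately show "norm (?g (of_real x)) \<le> M / x\<^sup>2" using bound[of "- x"] by simp
  qed
  also have "\<dots> = M / R - M / R'" using I by (simp add: integral_unique)
  also have "\<dots> \<le> M / R" using R M by simp
  finally show ?thesis by (simp add: eq)
qed

lemma power_le_fact_times_exp:
  assumes "(u::real) \<ge> 0"
  shows "u ^ K \<le> fact K * exp u"
proof -
  have "(\<Sum>n\<in>{K}. u ^ n /\<^sub>R fact n) \<le> (\<Sum>n. u ^ n /\<^sub>R fact n)"
    using assms by (intro sum_le_suminf summable_exp_generic) auto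
  then show ?thesis by (simp add: exp_def field_simps)
qed

text \<open>As \<open>s\<close> tends to 1 the factor \<open>s powr r\<close> loses its decay in \<open>r\<close>; the zero of order \<open>K\<close> replaces it by a decay
  of order \<open>r\<close> to the power \<open>- K\<close>, uniformly in \<open>s\<close>. With \<open>u = - ln s\<close> this is \<open>u ^ K \<le> fact K * exp u\<close>,
  rescaled.\<close>

lemma powr_times_power_le:
  assumes "0 < s" "s < 1" "0 < (r::real)"
  shows "s powr r * (1 - s) ^ K \<le> fact K / r ^ K"
proof -
  define u where "u = - ln s"
  have u: "u \<ge> 0" "1 - s \<le> u" using assms ln_le_minus_one[of s] by (auto simp: u_def)
  have "s powr r * (1 - s) ^ K \<le> exp (- (r * u)) * u ^ K"
    using assms u by (intro mult_mono power_mono) (auto simp: powr_def u_def)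
  also have "u ^ K = (r * u) ^ K / r ^ K" using assms by (simp add: power_mult_distrib)
  also have "\<dots> \<le> fact K * exp (r * u) / r ^ K"
    using assms u by (intro divide_right_mono power_le_fact_times_exp) auto
  finally show ?thesis by (simp add: exp_minus field_simps)
qed

text \<open>The bound is required off the half strip \<open>Re z < 0\<close>, \<open>\<bar>Im z\<bar> < 1\<close> inside the loop, where \<open>\<phi>\<close> may be singular.
  With \<open>K \<ge> P + 2\<close> the integrand, weighted by \<open>(1 - s) ^ K\<close>, is bounded by a multiple of \<open>1 / r\<^sup>2\<close> along the legs.\<close>

locale left_loop_kernel =
  fixes \<phi> :: "complex \<Rightarrow> complex" and d C :: real and P K :: nat
  assumes d_pos: "d > 0"
    and holomorphic: "\<phi> holomorphic_on {z. Im z \<noteq> 0 \<or> Re z > - d}"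
    and C_nonneg: "C \<ge> 0"
    and growth: "\<And>z. Re z \<ge> 0 \<or> \<bar>Im z\<bar> \<ge> 1 \<Longrightarrow> norm (\<phi> z) \<le> C * (1 + norm z) ^ P"
    and K_large: "K \<ge> P + 2"
begin

lemma continuous_kernel: "continuous_on loop_region \<phi>"
  by (rule continuous_on_subset[OF holomorphic_on_imp_continuous_on[OF holomorphic]])
     (use d_pos in \<open>auto simp: loop_region_def\<close>)

definition truncated :: "real \<Rightarrow> real \<Rightarrow> complex" where
  "truncated R s = contour_integral (left_loop R) (\<lambda>z. \<phi> z * of_real s powr (- z))"

lemma continuous_integrand: "s > 0 \<Longrightarrow> continuous_on loop_region (\<lambda>z. \<phi> z * of_real s powr (- z))"
  by (intro continuous_intros continuous_kernel) auto

lemma integrand_bound: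
  assumes "0 < s" "s < 1" "1 \<le> r" "\<bar>v\<bar> = 1"
  shows "norm (\<phi> (Complex (- r) v) * of_real s powr (- Complex (- r) v)) * (1 - s) ^ K \<le> (C * 3 ^ P * fact K) / r\<^sup>2"
proof -
  have "norm (Complex (- r) v) \<le> r + 1"
    using cmod_le[of "Complex (- r) v"] assms by simp
  then have "norm (\<phi> (Complex (- r) v)) \<le> C * (2 + r) ^ P"
    using assms C_nonneg
    by (intro order_trans[OF growth] mult_left_mono power_mono) auto
  also have "\<dots> \<le> C * (3 * r) ^ P"
    using assms C_nonneg by (intro mult_left_mono power_mono) auto
  finally have 1: "norm (\<phi> (Complex (- r) v)) \<le> C * (3 * r) ^ P" .
  have "norm (of_real s powr (- Complex (- r) v)) = s powr r"
    using assms by (simp add: norm_powr_real_powr)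
  then have "norm (\<phi> (Complex (- r) v) * of_real s powr (- Complex (- r) v)) * (1 - s) ^ K
      = norm (\<phi> (Complex (- r) v)) * (s powr r * (1 - s) ^ K)"
    by (simp add: norm_mult)
  also have "\<dots> \<le> (C * (3 * r) ^ P) * (fact K / r ^ K)"
    using assms 1 C_nonneg by (intro mult_mono powr_times_power_le) auto
  also have "\<dots> \<le> (C * (3 * r) ^ P) * (fact K / r ^ (P + 2))"
    using assms C_nonneg K_large by (intro mult_left_mono divide_left_mono power_increasing) auto
  also have "\<dots> = (C * 3 ^ P * fact K) / r\<^sup>2"
    using assms by (simp add: power_mult_distrib power_add field_simps power2_eq_square)
  finally show ?thesis .
qed

text \<open>The weight makes the convergence of the truncated integrals uniform over \<open>0 < s < 1\<close>.\<close>

lemma truncated_diff: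
  assumes s: "0 < s" "s < 1" and R: "1 \<le> R" "R \<le> R'"
  shows "norm (truncated R' s - truncated R s) * (1 - s) ^ K \<le> 2 * (C * 3 ^ P * fact K) / R"
proof -
  let ?f = "\<lambda>z. \<phi> z * of_real s powr (- z)"
  let ?M = "C * 3 ^ P * fact K / (1 - s) ^ K"
  have cont: "continuous_on (closed_segment (Complex (- r) v) (Complex (- r') v)) ?f"
    if "0 \<le> r" "0 \<le> r'" "\<bar>v\<bar> = 1" for r r' v
    by (rule continuous_on_subset[OF continuous_integrand[OF s(1)]])
       (use that in \<open>auto simp: loop_region_def dest!: horizontal_segmentD\<close>)
  have mem: "Complex (- R) v \<in> closed_segment (Complex (- R') v) (Complex 0 v)" for v
    using R by (auto simp: closed_segment_same_Im closed_segment_eq_real_ivl)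
  have leg: "norm (contour_integral (linepath (Complex (- R') v) (Complex (- R) v)) ?f) \<le> ?M / R"
    if "\<bar>v\<bar> = 1" for v
  proof (rule norm_contour_integral_leg_le[OF R cont])
    fix r assume "R \<le> r"
    then show "norm (?f (Complex (- r) v)) \<le> ?M / r\<^sup>2"
      using integrand_bound[OF s _ that, of r] R s by (simp add: field_simps)
  qed (use R C_nonneg s that in auto)
  have bot: "contour_integral (linepath (Complex (- R') (-1)) (Complex 0 (-1))) ?f
      = contour_integral (linepath (Complex (- R') (-1)) (Complex (- R) (-1))) ?f
        + contour_integral (linepath (Complex (- R) (-1)) (Complex 0 (-1))) ?f"
    using cont[of R' 0 "-1"] R by (intro contour_integral_split_linepath mem) auto
  have top: "contour_integral (linepath (Complex (- R') 1) (Complex 0 1)) ?f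
      = contour_integral (linepath (Complex (- R') 1) (Complex (- R) 1)) ?f
        + contour_integral (linepath (Complex (- R) 1) (Complex 0 1)) ?f"
    using cont[of R' 0 1] R by (intro contour_integral_split_linepath mem) auto
  have rev: "contour_integral (linepath (Complex 0 1) (Complex (- r) 1)) ?f
      = - contour_integral (linepath (Complex (- r) 1) (Complex 0 1)) ?f" for r
    by (metis contour_integral_reversepath reversepath_linepath valid_path_linepath)
  have "truncated R' s - truncated R s
      = contour_integral (linepath (Complex (- R') (-1)) (Complex (- R) (-1))) ?f
        - contour_integral (linepath (Complex (- R') 1) (Complex (- R) 1)) ?f"
    using R unfolding truncated_def
    by (simp add: contour_integral_left_loop(2)[OF continuous_integrand[OF s(1)]] bot top rev)
  also have "norm \<dots> \<le> ?M / R + ?M / R"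
    by (intro order_trans[OF norm_triangle_ineq4] add_mono leg) auto
  finally show ?thesis
    using s R by (simp add: field_simps)
qed

lemma truncated_limit:
  assumes s: "0 < s" "s < 1"
  obtains L where "((\<lambda>R. truncated R s) \<longlongrightarrow> L) at_top"
    "\<And>R. R \<ge> 1 \<Longrightarrow> norm (truncated R s - L) * (1 - s) ^ K \<le> 2 * (C * 3 ^ P * fact K) / R"
proof -
  define M where "M = 2 * (C * 3 ^ P * fact K) / (1 - s) ^ K"
  \<comment> \<open>For a fixed s the weight is a positive constant, so the uniform estimate also shows that the limit exists.\<close>
  have sK: "(1 - s) ^ K > 0" using s by simp
  have M: "M \<ge> 0" using C_nonneg s by (simp add: M_def)
  have diff: "norm (truncated R' s - truncated R s) \<le> M / R" if "1 \<le> R" "R \<le> R'" for R R'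
    using truncated_diff[OF s that] sK that by (simp add: M_def field_simps)
  have "Cauchy (\<lambda>n. truncated (real n) s)"
  proof (rule CauchyI')
    fix e :: real assume e: "e > 0"
    obtain N where N: "real N > M / e" using reals_Archimedean2 by blast
    show "\<exists>N. \<forall>m\<ge>N. \<forall>n>m. dist (truncated (real m) s) (truncated (real n) s) < e"
    proof (intro exI allI impI)
      fix m n assume mn: "m \<ge> Suc N" "n > m"
      then have "norm (truncated (real m) s - truncated (real n) s) \<le> M / real m"
        using diff[of "real m" "real n"] by (simp add: norm_minus_commute)
      also have "\<dots> < e"
      proof -
        have "M / e < real m" using N mn by linarith
        then show ?thesis using e mn by (simp add: field_simps)
      qed
      finally show "dist (truncated (real m) s) (truncated (real n) s) < e" by (simp add: dist_norm)
    qed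
  qed
  then obtain L where L: "(\<lambda>n. truncated (real n) s) \<longlonglongrightarrow> L"
    using Cauchy_convergent_iff convergent_def by blast
  have bnd: "norm (truncated R s - L) \<le> M / R" if R: "R \<ge> 1" for R
  proof (rule tendsto_upperbound)
    show "(\<lambda>n. norm (truncated R s - truncated (real n) s)) \<longlonglongrightarrow> norm (truncated R s - L)"
      by (intro tendsto_intros L)
    have "\<forall>\<^sub>F n in sequentially. real n \<ge> R"
      using filterlim_real_sequentially by (simp add: filterlim_at_top)
    then show "\<forall>\<^sub>F n in sequentially. norm (truncated R s - truncated (real n) s) \<le> M / R"
    proof eventually_elim
      case (elim n)
      then show ?case using diff[OF R elim] by (simp add: norm_minus_commute)
    qed
  qed simp
  have "((\<lambda>R. truncated R s) \<longlongrightarrow> L) at_top"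
  proof (rule LIM_zero_cancel, rule Lim_null_comparison)
    show "\<forall>\<^sub>F R in at_top. norm (truncated R s - L) \<le> M / R"
      using eventually_ge_at_top[of 1] by eventually_elim (rule bnd)
    show "((\<lambda>R. M / R) \<longlongrightarrow> 0) at_top" by real_asymp
  qed
  moreover have "norm (truncated R s - L) * (1 - s) ^ K \<le> 2 * (C * 3 ^ P * fact K) / R" if "R \<ge> 1" for R
    using bnd[OF that] sK that by (simp add: M_def field_simps)
  ultimately show ?thesis using that by blast
qed

text \<open>For the quotient of Gamma products this is the Meijer function.\<close>

definition loop_density :: "real \<Rightarrow> complex" where
  "loop_density s = 1 / (2 * of_real pi * \<i>) * Lim at_top (\<lambda>R. truncated R s)"

definition slack :: real where "slack = 2 * (C * 3 ^ P * fact K)"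

lemma slack_nonneg: "slack \<ge> 0"
  using C_nonneg by (simp add: slack_def)

text \<open>Nonnegativity of the density passes to the truncated integrals up to an error of order \<open>1 / R\<close>, so only
  the latter, which depend continuously on \<open>s\<close>, ever have to be integrated over \<open>s\<close>.\<close>

lemma Re_truncated_lower_bound:
  assumes s: "0 < s" "s < 1" and nonneg: "loop_density s \<in> \<real>\<^sub>\<ge>\<^sub>0" and R: "R \<ge> 1"
  shows "Re (1 / (2 * of_real pi * \<i>) * truncated R s) * (1 - s) ^ K \<ge> - (slack / R)"
proof -
  obtain L where L: "((\<lambda>R. truncated R s) \<longlongrightarrow> L) at_top"
    and bnd: "norm (truncated R s - L) * (1 - s) ^ K \<le> slack / R"
    using truncated_limit[OF s] R unfolding slack_def by metis
  let ?c = "1 / (2 * of_real pi * \<i>) :: complex"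
  have "loop_density s = ?c * L"
    using tendsto_Lim[OF _ L] by (simp add: loop_density_def)
  then have "Re (?c * L) \<ge> 0" using nonneg by (simp add: complex_nonneg_Reals_iff)
  moreover have "Re (?c * truncated R s) = Re (?c * L) + Re (?c * (truncated R s - L))"
    by (simp only: plus_complex.sel(1)[symmetric] distrib_left[symmetric]) simp
  ultimately have "Re (?c * truncated R s) \<ge> - norm (?c * (truncated R s - L))"
    using abs_Re_le_cmod[of "?c * (truncated R s - L)"] by linarith
  also have "norm (?c * (truncated R s - L)) = norm ?c * norm (truncated R s - L)"
    by (rule norm_mult)
  finally have "Re (?c * truncated R s) \<ge> - (norm ?c * norm (truncated R s - L))" .
  moreover have "norm ?c * norm (truncated R s - L) \<le> 1 * norm (truncated R s - L)"
    using pi_gt3 by (intro mult_right_mono) (auto simp: norm_divide norm_mult divide_le_eq)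
  ultimately have "Re (?c * truncated R s) \<ge> - norm (truncated R s - L)" by linarith
  then have "Re (?c * truncated R s) * (1 - s) ^ K \<ge> - norm (truncated R s - L) * (1 - s) ^ K"
    using s by (intro mult_right_mono) auto
  then show ?thesis using bnd by linarith
qed

text \<open>The integral of \<open>s powr (w - 1) * (1 - s) ^ K\<close> over \<open>[\<epsilon>, 1]\<close>, expanded by the binomial theorem. The cutoff
  \<open>\<epsilon> > 0\<close> keeps the integrand continuous, as the exchange of integrals requires.\<close>

definition incomplete_beta :: "real \<Rightarrow> complex \<Rightarrow> complex" where
  "incomplete_beta \<epsilon> w = (\<Sum>j\<le>K. (-1) ^ j * of_nat (K choose j) * (1 - of_real \<epsilon> powr (w + of_nat j)) / (w + of_nat j))"

lemma incomplete_beta_integral: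
  assumes "0 < \<epsilon>" "\<epsilon> < 1" "Re w > 0"
  shows "contour_integral (linepath (of_real \<epsilon>) 1) (\<lambda>s. s powr (w - 1) * (1 - s) ^ K) = incomplete_beta \<epsilon> w"
proof -
  let ?S = "{s. Re s > 0}"
  let ?F = "\<lambda>s. \<Sum>j\<le>K. (-1) ^ j * of_nat (K choose j) * (s powr (w + of_nat j) / (w + of_nat j))"
  have w: "w + of_nat j \<noteq> 0" for j using assms by (auto simp: complex_eq_iff)
  have der: "(?F has_field_derivative s powr (w - 1) * (1 - s) ^ K) (at s within ?S)" if s: "s \<in> ?S" for s
  proof -
    have s': "s \<notin> \<real>\<^sub>\<le>\<^sub>0" "s \<noteq> 0" using s by (auto simp: complex_nonpos_Reals_iff)
    have "((\<lambda>s. s powr (w + of_nat j) / (w + of_nat j)) has_field_derivative s powr (w + of_nat j - 1)) (at s)" for j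
      using DERIV_cdivide[OF has_field_derivative_powr[OF s'(1), of "w + of_nat j"], of "w + of_nat j"] w[of j]
      by simp
    then have "(?F has_field_derivative (\<Sum>j\<le>K. (-1) ^ j * of_nat (K choose j) * s powr (w + of_nat j - 1))) (at s)"
      by (intro DERIV_sum DERIV_cmult) auto
    moreover have "(\<Sum>j\<le>K. (-1) ^ j * of_nat (K choose j) * s powr (w + of_nat j - 1)) = s powr (w - 1) * (1 - s) ^ K"
    proof -
      have "s powr (w + of_nat j - 1) = s powr (w - 1) * s ^ j" for j
      proof -
        have "w + of_nat j - 1 = (w - 1) + of_nat j" by simp
        then have "s powr (w + of_nat j - 1) = s powr (w - 1) * s powr (of_nat j)" by (simp only: powr_add)
        then show ?thesis using s' by simp
      qed
      moreover have "(1 - s) ^ K = (\<Sum>j\<le>K. of_nat (K choose j) * (- s) ^ j)"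
        using binomial_ring[of "- s" 1 K] by simp
      moreover have "(- s) ^ j = (-1) ^ j * s ^ j" for j by (rule power_minus)
      ultimately show ?thesis by (simp add: sum_distrib_left mult_ac)
    qed
    ultimately show ?thesis by (simp add: has_field_derivative_at_within)
  qed
  have "((\<lambda>s. s powr (w - 1) * (1 - s) ^ K) has_contour_integral
      (?F (pathfinish (linepath (of_real \<epsilon>) 1)) - ?F (pathstart (linepath (of_real \<epsilon>) 1)))) (linepath (of_real \<epsilon>) 1)"
  proof (rule contour_integral_primitive[OF der])
    show "path_image (linepath (complex_of_real \<epsilon>) 1) \<subseteq> ?S"
      using assms closed_segment_subset[of "complex_of_real \<epsilon>" ?S 1]
      by (simp add: convex_halfspace_Re_gt)
  qed auto
  then have "contour_integral (linepath (of_real \<epsilon>) 1) (\<lambda>s. s powr (w - 1) * (1 - s) ^ K) = ?F 1 - ?F (of_real \<epsilon>)"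
    by (simp add: contour_integral_unique)
  also have "\<dots> = incomplete_beta \<epsilon> w"
    by (simp add: incomplete_beta_def sum_subtractf[symmetric] right_diff_distrib diff_divide_distrib)
  finally show ?thesis .
qed

text \<open>Integrate the lower bound for the truncated integrals against \<open>s powr (t - 1)\<close> over \<open>[\<epsilon>, 1]\<close>, and exchange
  this integration with the loop integral.\<close>

lemma Re_loop_incomplete_beta_lower_bound:
  assumes nonneg: "\<And>s. 0 < s \<Longrightarrow> s < 1 \<Longrightarrow> loop_density s \<in> \<real>\<^sub>\<ge>\<^sub>0"
    and R: "R \<ge> 1" and \<epsilon>: "0 < \<epsilon>" "\<epsilon> < 1" and t: "t > 0"
  shows "Re (1 / (2 * of_real pi * \<i>) * contour_integral (left_loop R) (\<lambda>z. \<phi> z * incomplete_beta \<epsilon> (of_real t - z)))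
    \<ge> - (slack / (R * t))"
proof -
  let ?c = "1 / (2 * of_real pi * \<i>) :: complex"
  let ?\<gamma> = "linepath (complex_of_real \<epsilon>) 1"
  define f where "f s z = \<phi> z * (s powr (of_real t - z - 1) * (1 - s) ^ K)" for s z
  define h where "h s = contour_integral (left_loop R) (f s)" for s
  have pos: "Re s > 0" if "s \<in> closed_segment (complex_of_real \<epsilon>) 1" for s
    using that \<epsilon> closed_segment_subset[of "complex_of_real \<epsilon>" "{s. Re s > 0}" 1]
    by (auto simp: convex_halfspace_Re_gt)
  have "continuous_on (closed_segment (complex_of_real \<epsilon>) 1 \<times> loop_region)
      (\<lambda>p. \<phi> (snd p) * (fst p powr (of_real t - snd p - 1) * (1 - fst p) ^ K))"
    by (intro continuous_intros continuous_on_compose2[OF continuous_kernel])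
       (use pos in \<open>fastforce+\<close>)
  then have cont: "continuous_on (closed_segment (complex_of_real \<epsilon>) 1 \<times> loop_region) (\<lambda>(s, z). f s z)"
    by (simp add: f_def split_beta)
  have R0: "R \<ge> 0" using R by simp
  have hint: "h contour_integrable_on ?\<gamma>"
    unfolding h_def by (rule contour_integral_left_loop_swap(1)[OF cont R0])
  have "contour_integral ?\<gamma> h = contour_integral (left_loop R) (\<lambda>z. contour_integral ?\<gamma> (\<lambda>s. f s z))"
    unfolding h_def by (rule contour_integral_left_loop_swap(2)[OF cont R0])
  also have "\<dots> = contour_integral (left_loop R) (\<lambda>z. \<phi> z * incomplete_beta \<epsilon> (of_real t - z))"
  proof (rule contour_integral_eq)
    fix z assume "z \<in> path_image (left_loop R)"
    then have z: "Re z \<le> 0" using path_image_left_loop[OF R0] by (auto simp: loop_region_def)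
    have "continuous_on (closed_segment (complex_of_real \<epsilon>) 1) (\<lambda>s. s powr (of_real t - z - 1) * (1 - s) ^ K)"
      by (intro continuous_intros) (use pos in \<open>fastforce+\<close>)
    then have "(\<lambda>s. s powr (of_real t - z - 1) * (1 - s) ^ K) contour_integrable_on ?\<gamma>"
      by (rule contour_integrable_continuous_linepath)
    then show "contour_integral ?\<gamma> (\<lambda>s. f s z) = \<phi> z * incomplete_beta \<epsilon> (of_real t - z)"
      unfolding f_def using incomplete_beta_integral[OF \<epsilon>, of "of_real t - z"] z t
      by (simp add: contour_integral_lmul)
  qed
  finally have J: "contour_integral ?\<gamma> h = contour_integral (left_loop R) (\<lambda>z. \<phi> z * incomplete_beta \<epsilon> (of_real t - z))" .
  have "(h has_contour_integral contour_integral ?\<gamma> h) ?\<gamma>"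
    using hint by (rule has_contour_integral_integral)
  then have "((\<lambda>s. h (of_real s)) has_integral contour_integral ?\<gamma> h) {\<epsilon>..1}"
    using \<epsilon> by (subst (asm) has_contour_integral_linepath_Reals_iff) auto
  then have "((\<lambda>s. ?c * h (of_real s)) has_integral ?c * contour_integral ?\<gamma> h) {\<epsilon>..1}"
    by (rule has_integral_mult_right)
  from has_integral_linear[OF this bounded_linear_Re] have I1: "((\<lambda>s. Re (?c * h (of_real s))) has_integral Re (?c * contour_integral ?\<gamma> h)) {\<epsilon>..1}"
    by (simp only: o_def)
  have I2: "((\<lambda>s. - (slack / R) * s powr (t - 1)) has_integral - (slack / R) * (1 powr t / t - \<epsilon> powr t / t)) {\<epsilon>..1}"
  proof (intro has_integral_mult_right fundamental_theorem_of_calculus)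
    fix s assume "s \<in> {\<epsilon>..1}"
    then have "s > 0" using \<epsilon> by auto
    then have "((\<lambda>s. s powr t / t) has_real_derivative s powr (t - 1)) (at s within {\<epsilon>..1})"
      using t by (auto intro!: derivative_eq_intros)
    then show "((\<lambda>s. s powr t / t) has_vector_derivative s powr (t - 1)) (at s within {\<epsilon>..1})"
      by (simp add: has_real_derivative_iff_has_vector_derivative)
  qed (use \<epsilon> in auto)
  have le: "- (slack / R) * s powr (t - 1) \<le> Re (?c * h (of_real s))" if s: "s \<in> {\<epsilon>..1}" for s
  proof (cases "s = 1")
    case True
    have "f 1 = (\<lambda>z. 0)" using K_large by (simp add: f_def fun_eq_iff)
    then have "h 1 = 0" by (simp add: h_def)
    then show ?thesis using True slack_nonneg R by simp
  next
    case False
    then have s01: "0 < s" "s < 1" using s \<epsilon> by auto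
    have "f (of_real s) z = of_real (s powr (t - 1) * (1 - s) ^ K) * (\<phi> z * of_real s powr (- z))" for z
    proof -
      have "of_real t - z - 1 = complex_of_real (t - 1) + (- z)" by simp
      then have "complex_of_real s powr (of_real t - z - 1) = of_real s powr (of_real (t - 1)) * of_real s powr (- z)"
        by (simp only: powr_add)
      also have "complex_of_real s powr (of_real (t - 1)) = of_real (s powr (t - 1))"
        using s01 by (intro powr_of_real) simp
      finally show ?thesis by (simp add: f_def)
    qed
    then have "f (of_real s) = (\<lambda>z. of_real (s powr (t - 1) * (1 - s) ^ K) * (\<phi> z * of_real s powr (- z)))"
      by (rule ext)
    then have "h (of_real s) = of_real (s powr (t - 1) * (1 - s) ^ K) * truncated R s"
      unfolding h_def truncated_def
      using contour_integral_left_loop(1)[OF continuous_integrand[OF s01(1)] R0]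
      by (simp only: contour_integral_lmul)
    then have "Re (?c * h (of_real s)) = Re (of_real (s powr (t - 1) * (1 - s) ^ K) * (?c * truncated R s))"
      by (simp only: mult.left_commute)
    also have "\<dots> = s powr (t - 1) * (Re (?c * truncated R s) * (1 - s) ^ K)"
    proof -
      have "Re (of_real u * w) = u * Re w" for u w by simp
      then show ?thesis by (simp only: mult.assoc mult.commute[of "Re _"])
    qed
    also have "\<dots> \<ge> s powr (t - 1) * (- (slack / R))"
      by (intro mult_left_mono Re_truncated_lower_bound s01 nonneg R) auto
    finally show ?thesis by (simp add: mult.commute)
  qed
  have "- (slack / R) * (1 powr t / t - \<epsilon> powr t / t) \<le> Re (?c * contour_integral ?\<gamma> h)"
    by (rule has_integral_le[OF I2 I1]) (rule le)
  moreover have "(slack / R) * (1 powr t / t - \<epsilon> powr t / t) \<le> (slack / R) * (1 / t)"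
    using slack_nonneg R t by (intro mult_left_mono) auto
  moreover have "slack / (R * t) = (slack / R) * (1 / t)" by simp
  ultimately show ?thesis unfolding J by linarith
qed

end

section \<open>Residues to the right of the loop\<close>

text \<open>The complete Beta integral \<open>Beta w (K + 1)\<close>. The left side displays its poles and residues, the right side its
  decay of order \<open>K + 1\<close>.\<close>

lemma sum_binomial_partial_fractions:
  fixes w :: complex
  assumes "\<And>j. j \<le> K \<Longrightarrow> w + of_nat j \<noteq> 0"
  shows "(\<Sum>j\<le>K. (-1) ^ j * of_nat (K choose j) / (w + of_nat j)) = fact K / pochhammer w (Suc K)"
  using assms
proof (induction K arbitrary: w)
  case 0
  then show ?case by simp
next
  case (Suc K)
  let ?S = "\<lambda>K w. \<Sum>j\<le>K. (-1) ^ j * of_nat (K choose j) / (w + of_nat j)"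
  have nz: "w + of_nat j \<noteq> 0" if "j \<le> Suc K" for j using Suc.prems that by blast
  have nz1: "(w + 1) + of_nat j \<noteq> 0" if "j \<le> K" for j using nz[of "Suc j"] that by (simp add: add_ac)
  have "?S (Suc K) w = 1 / w + (\<Sum>j\<le>K. (-1) ^ Suc j * of_nat (Suc K choose Suc j) / (w + of_nat (Suc j)))"
    by (subst sum.atMost_Suc_shift) simp
  also have "(\<Sum>j\<le>K. (-1) ^ Suc j * of_nat (Suc K choose Suc j) / (w + of_nat (Suc j)))
      = (\<Sum>j\<le>K. (-1) ^ Suc j * of_nat (K choose Suc j) / (w + of_nat (Suc j))) - ?S K (w + 1)"
    unfolding sum_subtractf[symmetric]
  proof (intro sum.cong refl)
    fix j
    have shift: "w + of_nat (Suc j) = w + 1 + of_nat j" by simp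
    show "(-1) ^ Suc j * of_nat (Suc K choose Suc j) / (w + of_nat (Suc j))
        = (-1) ^ Suc j * of_nat (K choose Suc j) / (w + of_nat (Suc j))
          - (-1) ^ j * of_nat (K choose j) / (w + 1 + of_nat j)"
      unfolding shift by (simp add: distrib_left add_divide_distrib diff_divide_distrib)
  qed
  also have "1 / w + ((\<Sum>j\<le>K. (-1) ^ Suc j * of_nat (K choose Suc j) / (w + of_nat (Suc j))) - ?S K (w + 1))
      = (\<Sum>j\<le>Suc K. (-1) ^ j * of_nat (K choose j) / (w + of_nat j)) - ?S K (w + 1)"
    by (subst sum.atMost_Suc_shift) simp
  also have "\<dots> = ?S K w - ?S K (w + 1)" by simp
  also have "\<dots> = fact K / pochhammer w (Suc K) - fact K / pochhammer (w + 1) (Suc K)"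
    by (subst (1 2) Suc.IH) (use nz nz1 in auto)
  also have "\<dots> = fact (Suc K) / pochhammer w (Suc (Suc K))"
  proof -
    define Q where "Q = pochhammer (w + 1) K"
    have 1: "pochhammer w (Suc K) = w * Q" by (simp add: pochhammer_rec Q_def)
    have 2: "pochhammer (w + 1) (Suc K) = Q * (w + 1 + of_nat K)" by (simp add: pochhammer_Suc Q_def)
    have 3: "pochhammer w (Suc (Suc K)) = w * (Q * (w + 1 + of_nat K))"
      unfolding 2[symmetric] by (rule pochhammer_rec)
    have "w \<noteq> 0" "w + 1 + of_nat K \<noteq> 0" using nz[of 0] nz1[of K] by auto
    moreover have "Q \<noteq> 0"
      using nz1 unfolding Q_def pochhammer_eq_0_iff
      by (metis add.commute add_eq_0_iff less_imp_le)
    ultimately show ?thesis unfolding 1 2 3 by (simp add: divide_simps) (simp add: algebra_simps)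
  qed
  finally show ?case .
qed

lemma norm_contour_integral_left_loop_le:
  assumes cont: "continuous_on loop_region f" and R: "R \<ge> 0"
    and bound: "\<And>z. z \<in> loop_region \<Longrightarrow> Re z \<ge> - R \<Longrightarrow> norm (f z) \<le> B" and B: "B \<ge> 0"
  shows "norm (contour_integral (left_loop R) f) \<le> B * (2 * R + 2)"
proof -
  have leg: "norm (contour_integral (linepath c d) f) \<le> B * norm (d - c)"
    if "closed_segment c d \<subseteq> loop_region" "Re c \<ge> - R" "Re d \<ge> - R" for c d
  proof (rule contour_integral_bound_linepath)
    show "f contour_integrable_on linepath c d"
      by (intro contour_integrable_continuous_linepath continuous_on_subset[OF cont] that)
    have "closed_segment c d \<subseteq> {z. Re z \<ge> - R}"
      using that by (intro closed_segment_subset) (auto simp: convex_halfspace_Re_ge)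
    then show "norm (f x) \<le> B" if "x \<in> closed_segment c d" for x
      using bound that \<open>closed_segment c d \<subseteq> loop_region\<close> by blast
  qed (rule B)
  have "norm (contour_integral (left_loop R) f) \<le>
      B * norm (Complex 0 (- 1) - Complex (- R) (- 1)) + B * norm (Complex 0 1 - Complex 0 (- 1))
      + B * norm (Complex (- R) 1 - Complex 0 1)"
    unfolding contour_integral_left_loop(2)[OF cont R]
    using R by (intro order_trans[OF norm_triangle_ineq] add_mono leg loop_segments) auto
  also have "\<dots> = B * (2 * R + 2)"
    using R by (simp add: norm_complex_def complex_diff algebra_simps)
  finally show ?thesis .
qed

lemma contour_integral_rectpath_edges:
  assumes "continuous_on (path_image (rectpath (Complex x0 y0) (Complex x1 y1))) f"
  shows "contour_integral (rectpath (Complex x0 y0) (Complex x1 y1)) f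
    = contour_integral (linepath (Complex x0 y0) (Complex x1 y0)) f
      + contour_integral (linepath (Complex x1 y0) (Complex x1 y1)) f
      + contour_integral (linepath (Complex x1 y1) (Complex x0 y1)) f
      + contour_integral (linepath (Complex x0 y1) (Complex x0 y0)) f"
proof -
  have "path_image (rectpath (Complex x0 y0) (Complex x1 y1))
      = closed_segment (Complex x0 y0) (Complex x1 y0) \<union> (closed_segment (Complex x1 y0) (Complex x1 y1)
        \<union> (closed_segment (Complex x1 y1) (Complex x0 y1) \<union> closed_segment (Complex x0 y1) (Complex x0 y0)))"
    by (simp add: rectpath_def Let_def path_image_join)
  note sub = assms[unfolded this]
  have "f contour_integrable_on linepath (Complex x0 y0) (Complex x1 y0)"
    "f contour_integrable_on linepath (Complex x1 y0) (Complex x1 y1)"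
    "f contour_integrable_on linepath (Complex x1 y1) (Complex x0 y1)"
    "f contour_integrable_on linepath (Complex x0 y1) (Complex x0 y0)"
    by (intro contour_integrable_continuous_linepath continuous_on_subset[OF sub]; blast)+
  then show ?thesis
    by (simp add: rectpath_def Let_def contour_integrable_joinI valid_path_join)
qed

context left_loop_kernel
begin

definition complete_beta :: "complex \<Rightarrow> complex" where
  "complete_beta w = (\<Sum>j\<le>K. (-1) ^ j * of_nat (K choose j) / (w + of_nat j))"

lemma incomplete_beta_approx:
  assumes "0 < \<epsilon>" "\<epsilon> < 1" "t > 0" "Re w \<ge> t"
  shows "norm (incomplete_beta \<epsilon> w - complete_beta w) \<le> (2 ^ K / t) * \<epsilon> powr t"
proof -
  have "incomplete_beta \<epsilon> w - complete_beta w
      = (\<Sum>j\<le>K. - ((-1) ^ j * of_nat (K choose j) * of_real \<epsilon> powr (w + of_nat j) / (w + of_nat j)))"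
    by (simp add: incomplete_beta_def complete_beta_def sum_subtractf[symmetric] right_diff_distrib diff_divide_distrib)
  also have "norm \<dots> \<le> (\<Sum>j\<le>K. real (K choose j) * (\<epsilon> powr t / t))"
  proof (rule sum_norm_le)
    fix j
    have "Re w + real j \<le> norm (w + of_nat j)" using complex_Re_le_cmod[of "w + of_nat j"] by simp
    then have n: "t \<le> norm (w + of_nat j)" using assms by linarith
    have "norm (of_real \<epsilon> powr (w + of_nat j)) = \<epsilon> powr (Re w + real j)"
      using assms by (simp add: norm_powr_real_powr)
    also have "\<dots> \<le> \<epsilon> powr t" using assms by (intro powr_mono') auto
    finally have "norm (of_real \<epsilon> powr (w + of_nat j)) / norm (w + of_nat j) \<le> \<epsilon> powr t / t"
      using n assms by (intro frac_le) auto
    then show "norm (- ((-1) ^ j * of_nat (K choose j) * of_real \<epsilon> powr (w + of_nat j) / (w + of_nat j)))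
        \<le> real (K choose j) * (\<epsilon> powr t / t)"
      by (simp add: norm_mult norm_divide norm_power mult_left_mono flip: times_divide_eq_right)
  qed
  also have "\<dots> = (2 ^ K / t) * \<epsilon> powr t"
    unfolding sum_distrib_right[symmetric] of_nat_sum[symmetric] choose_row_sum by simp
  finally show ?thesis .
qed

lemma continuous_times_beta:
  assumes "t > 0"
  shows "continuous_on loop_region (\<lambda>z. \<phi> z * complete_beta (of_real t - z))"
    and "\<epsilon> > 0 \<Longrightarrow> continuous_on loop_region (\<lambda>z. \<phi> z * incomplete_beta \<epsilon> (of_real t - z))"
proof -
  have nz: "of_real t - z + of_nat j \<noteq> 0" if "z \<in> loop_region" for z j
    using that assms by (auto simp: loop_region_def complex_eq_iff)
  show "continuous_on loop_region (\<lambda>z. \<phi> z * complete_beta (of_real t - z))"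
    unfolding complete_beta_def by (intro continuous_intros continuous_kernel) (use nz in auto)
  show "continuous_on loop_region (\<lambda>z. \<phi> z * incomplete_beta \<epsilon> (of_real t - z))" if "\<epsilon> > 0"
    unfolding incomplete_beta_def using that by (intro continuous_intros continuous_kernel) (use nz in auto)
qed

text \<open>The cutoff is removed: its effect is of order \<open>\<epsilon> powr t\<close>, uniformly on the loop, because \<open>Re z \<le> 0\<close>
  there.\<close>

lemma Re_loop_complete_beta_lower_bound:
  assumes nonneg: "\<And>s. 0 < s \<Longrightarrow> s < 1 \<Longrightarrow> loop_density s \<in> \<real>\<^sub>\<ge>\<^sub>0"
    and R: "R \<ge> 1" and t: "t > 0"
  shows "Re (1 / (2 * of_real pi * \<i>) * contour_integral (left_loop R) (\<lambda>z. \<phi> z * complete_beta (of_real t - z)))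
    \<ge> - (slack / (R * t))"
proof -
  let ?c = "1 / (2 * of_real pi * \<i>) :: complex"
  define X where "X = contour_integral (left_loop R) (\<lambda>z. \<phi> z * complete_beta (of_real t - z))"
  define Y where "Y \<epsilon> = contour_integral (left_loop R) (\<lambda>z. \<phi> z * incomplete_beta \<epsilon> (of_real t - z))" for \<epsilon>
  define B where "B = C * (3 + R) ^ P * (2 ^ K / t) * (2 * R + 2)"
  have R0: "R \<ge> 0" using R by simp
  have diff: "norm (Y \<epsilon> - X) \<le> B * \<epsilon> powr t" if \<epsilon>: "0 < \<epsilon>" "\<epsilon> < 1" for \<epsilon>
  proof -
    note c = continuous_times_beta(2)[OF t \<epsilon>(1)] continuous_times_beta(1)[OF t]
    have "Y \<epsilon> - X = contour_integral (left_loop R)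
        (\<lambda>z. \<phi> z * incomplete_beta \<epsilon> (of_real t - z) - \<phi> z * complete_beta (of_real t - z))"
      unfolding X_def Y_def
      by (rule contour_integral_diff[symmetric]) (intro contour_integral_left_loop(1) c R0)+
    also have "norm \<dots> \<le> (C * (3 + R) ^ P * ((2 ^ K / t) * \<epsilon> powr t)) * (2 * R + 2)"
    proof (rule norm_contour_integral_left_loop_le[OF continuous_on_diff[OF c] R0])
      fix z assume z: "z \<in> loop_region" "Re z \<ge> - R"
      have "norm z \<le> R + 1"
        using z cmod_le[of z] by (auto simp: loop_region_def)
      then have "norm (\<phi> z) \<le> C * (3 + R) ^ P"
        using z C_nonneg by (intro order_trans[OF growth] mult_left_mono power_mono) (auto simp: loop_region_def)
      moreover have "norm (incomplete_beta \<epsilon> (of_real t - z) - complete_beta (of_real t - z)) \<le> (2 ^ K / t) * \<epsilon> powr t"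
        using z by (intro incomplete_beta_approx \<epsilon> t) (auto simp: loop_region_def)
      ultimately show "norm (\<phi> z * incomplete_beta \<epsilon> (of_real t - z) - \<phi> z * complete_beta (of_real t - z))
          \<le> C * (3 + R) ^ P * ((2 ^ K / t) * \<epsilon> powr t)"
        unfolding right_diff_distrib[symmetric] norm_mult
        using C_nonneg R by (intro mult_mono) auto
    qed (use C_nonneg R t in auto)
    finally show ?thesis by (simp add: B_def mult_ac)
  qed
  have "- (slack / (R * t)) - 0 \<le> Re (?c * X)"
  proof (rule tendsto_le)
    show "((\<lambda>\<epsilon>. - (slack / (R * t)) - B * \<epsilon> powr t) \<longlongrightarrow> - (slack / (R * t)) - 0) (at_right 0)"
    proof (intro tendsto_intros)
      have "((\<lambda>\<epsilon>::real. \<epsilon> powr t) \<longlongrightarrow> 0) (at_right 0)" using t by real_asymp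
      then show "((\<lambda>\<epsilon>. B * \<epsilon> powr t) \<longlongrightarrow> 0) (at_right 0)" by (rule tendsto_mult_right_zero)
    qed
    have "\<forall>\<^sub>F \<epsilon> in at_right (0::real). \<epsilon> \<in> {0<..<1}"
      by (rule eventually_at_right_real) simp
    then show "\<forall>\<^sub>F \<epsilon> in at_right 0. - (slack / (R * t)) - B * \<epsilon> powr t \<le> Re (?c * X)"
    proof eventually_elim
      case (elim \<epsilon>)
      then have \<epsilon>: "0 < \<epsilon>" "\<epsilon> < 1" by auto
      have "Re (?c * Y \<epsilon>) = Re (?c * X) + Re (?c * (Y \<epsilon> - X))"
        by (simp only: plus_complex.sel(1)[symmetric] distrib_left[symmetric]) simp
      moreover have "Re (?c * (Y \<epsilon> - X)) \<le> norm ?c * norm (Y \<epsilon> - X)"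
        by (rule order_trans[OF complex_Re_le_cmod norm_mult_ineq])
      moreover have "norm ?c * norm (Y \<epsilon> - X) \<le> 1 * norm (Y \<epsilon> - X)"
        using pi_gt3 by (intro mult_right_mono) (auto simp: norm_divide norm_mult divide_le_eq)
      moreover have "Re (?c * Y \<epsilon>) \<ge> - (slack / (R * t))"
        unfolding Y_def by (rule Re_loop_incomplete_beta_lower_bound[OF nonneg R \<epsilon> t])
      ultimately show ?case using diff[OF \<epsilon>] by linarith
    qed
  qed simp_all
  then show ?thesis by (simp add: X_def)
qed

text \<open>As a function of \<open>z\<close> its poles are the points \<open>t + j\<close>, to the right of the loop.\<close>

lemma complete_beta_holomorphic:
  assumes "\<And>z j. z \<in> A \<Longrightarrow> j \<le> K \<Longrightarrow> z \<noteq> of_real t + of_nat j"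
  shows "(\<lambda>z. complete_beta (of_real t - z)) holomorphic_on A"
  unfolding complete_beta_def
  by (intro holomorphic_intros) (use assms in \<open>force simp: algebra_simps\<close>)

text \<open>The loop is completed by the sides of the square \<open>[- R, R] \<times> [- R, R]\<close>. The lines \<open>Im z = - 1\<close> and \<open>Im z = 1\<close>
  cut the region between them into a rectangle below, one above, and one to the right of the imaginary
  axis; only the last one contains the poles \<open>t + j\<close>. What remains is the integral over the sides of the
  square, estimated by its length times the maximum of the integrand.\<close>

lemma loop_residues:
  assumes t: "t > 0" and R: "R \<ge> 2 * (t + real K) + 1"
  shows "norm (contour_integral (left_loop R) (\<lambda>z. \<phi> z * complete_beta (of_real t - z))
    - 2 * of_real pi * \<i> * (\<Sum>j\<le>K. (-1) ^ j * of_nat (K choose j) * \<phi> (of_real (t + real j))))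
    \<le> 8 * R * (C * (1 + 2 * R) ^ P * (fact K / (R - t - real K) ^ Suc K))"
proof -
  let ?F = "\<lambda>z. \<phi> z * complete_beta (of_real t - z)"
  let ?E = "C * (1 + 2 * R) ^ P * (fact K / (R - t - real K) ^ Suc K)"
  let ?ci = "\<lambda>a b. contour_integral (linepath a b) ?F"
  define S where "S = (\<Sum>j\<le>K. (-1) ^ j * of_nat (K choose j) * \<phi> (of_real (t + real j)))"
  define Q where "Q = {z. (Im z \<noteq> 0 \<or> Re z > - d) \<and> (Im z \<noteq> 0 \<or> Re z \<le> 0 \<or> Re z \<ge> R)}"
  have R1: "R \<ge> 1" "R > t + real K" using R t by auto
  have E: "?E \<ge> 0" using C_nonneg R1 by auto
  \<comment> \<open>All edges of the three rectangles lie in Q, while the poles lie in the open interval from 0 to R.\<close>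
  have notpole: "z \<noteq> of_real t + of_nat j" if "z \<in> Q" "j \<le> K" for z j
  proof
    assume z: "z = of_real t + of_nat j"
    have "real j \<le> real K" using \<open>j \<le> K\<close> by simp
    then show False using z \<open>z \<in> Q\<close> R1 t by (auto simp: Q_def)
  qed
  have "?F holomorphic_on Q"
    by (intro holomorphic_intros complete_beta_holomorphic holomorphic_on_subset[OF holomorphic] notpole)
       (auto simp: Q_def)
  note holQ = this
  then have contQ: "continuous_on Q ?F" by (rule holomorphic_on_imp_continuous_on)
  have cont: "continuous_on A ?F" if "A \<subseteq> Q" for A
    using contQ that by (rule continuous_on_subset)
  have rect: "path_image (rectpath (Complex x0 y0) (Complex x1 y1))
      = {z. x0 \<le> Re z \<and> Re z \<le> x1 \<and> y0 \<le> Im z \<and> Im z \<le> y1} - {z. x0 < Re z \<and> Re z < x1 \<and> y0 < Im z \<and> Im z < y1}"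
    if "x0 \<le> x1" "y0 \<le> y1" for x0 x1 y0 y1
    by (subst path_image_rectpath_cbox_minus_box) (use that in \<open>auto simp: in_cbox_complex_iff in_box_complex_iff\<close>)
  \<comment> \<open>A rectangle off the real axis lies in an open half plane on which the integrand is holomorphic.\<close>
  have outer: "contour_integral (rectpath (Complex x0 y0) (Complex x1 y1)) ?F = 0"
    if "x0 \<le> x1" "y0 \<le> y1" "y0 > 0 \<or> y1 < 0" for x0 x1 y0 y1
  proof -
    have "\<exists>H. convex H \<and> H \<subseteq> {z. Im z \<noteq> 0} \<and> {z. x0 \<le> Re z \<and> Re z \<le> x1 \<and> y0 \<le> Im z \<and> Im z \<le> y1} \<subseteq> H"
    proof (cases "y0 > 0")
      case True
      then show ?thesis by (intro exI[of _ "{z. Im z > 0}"]) (auto simp: convex_halfspace_Im_gt)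
    next
      case False
      then show ?thesis using that by (intro exI[of _ "{z. Im z < 0}"]) (auto simp: convex_halfspace_Im_lt)
    qed
    then obtain H where H: "convex H" "H \<subseteq> {z. Im z \<noteq> 0}"
      "{z. x0 \<le> Re z \<and> Re z \<le> x1 \<and> y0 \<le> Im z \<and> Im z \<le> y1} \<subseteq> H" by blast
    have "(?F has_contour_integral 0) (rectpath (Complex x0 y0) (Complex x1 y1))"
    proof (rule Cauchy_theorem_convex_simple[OF _ H(1)])
      show "?F holomorphic_on H"
        by (rule holomorphic_on_subset[OF holQ]) (use H(2) in \<open>auto simp: Q_def\<close>)
      show "path_image (rectpath (Complex x0 y0) (Complex x1 y1)) \<subseteq> H"
        unfolding rect[OF that(1,2)] using H(3) by blast
    qed auto
    then show ?thesis by (rule contour_integral_unique)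
  qed
  have top: "?ci (Complex (- R) 1) (Complex R 1) + ?ci (Complex R 1) (Complex R R)
      + ?ci (Complex R R) (Complex (- R) R) + ?ci (Complex (- R) R) (Complex (- R) 1) = 0"
  proof -
    have "path_image (rectpath (Complex (- R) 1) (Complex R R)) \<subseteq> Q" using R1 by (auto simp: rect Q_def)
    from contour_integral_rectpath_edges[OF cont[OF this]] outer[of "- R" R 1 R] R1
    show ?thesis by simp
  qed
  have bot: "?ci (Complex (- R) (- R)) (Complex R (- R)) + ?ci (Complex R (- R)) (Complex R (- 1))
      + ?ci (Complex R (- 1)) (Complex (- R) (- 1)) + ?ci (Complex (- R) (- 1)) (Complex (- R) (- R)) = 0"
  proof -
    have "path_image (rectpath (Complex (- R) (- R)) (Complex R (- 1))) \<subseteq> Q" using R1 by (auto simp: rect Q_def)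
    from contour_integral_rectpath_edges[OF cont[OF this]] outer[of "- R" R "- R" "- 1"] R1
    show ?thesis by simp
  qed
  have mid: "?ci (Complex 0 (- 1)) (Complex R (- 1)) + ?ci (Complex R (- 1)) (Complex R 1)
      + ?ci (Complex R 1) (Complex 0 1) + ?ci (Complex 0 1) (Complex 0 (- 1)) = - (2 * of_real pi * \<i> * S)"
  proof -
    let ?\<gamma> = "rectpath (Complex 0 (- 1)) (Complex R 1)"
    have pim: "path_image ?\<gamma> \<subseteq> {z. Re z > - d}" "path_image ?\<gamma> \<subseteq> Q"
      using R1 d_pos by (auto simp: rect Q_def)
    have "((\<lambda>z. \<phi> z / (z - of_real (t + real j))) has_contour_integral
        (2 * pi * \<i> * winding_number ?\<gamma> (of_real (t + real j)) * \<phi> (of_real (t + real j)))) ?\<gamma>"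
      if "j \<le> K" for j
    proof (rule Cauchy_integral_formula_convex_simple[of "{z. Re z > - d}"])
      show "\<phi> holomorphic_on {z. Re z > - d}"
        by (rule holomorphic_on_subset[OF holomorphic]) auto
      have "open {z. Re z > - d}" by (rule open_halfspace_Re_gt)
      then show "complex_of_real (t + real j) \<in> interior {z. Re z > - d}"
        using t d_pos by (simp add: interior_open add_pos_nonneg)
      show "path_image ?\<gamma> \<subseteq> {z. Re z > - d} - {complex_of_real (t + real j)}"
        using pim notpole[OF _ that] by auto
    qed (auto simp: convex_halfspace_Re_gt)
    moreover have "winding_number ?\<gamma> (of_real (t + real j)) = 1" if "j \<le> K" for j
    proof (rule winding_number_rectpath)
      have "real j \<le> real K" using that by simp
      then show "complex_of_real (t + real j) \<in> box (Complex 0 (- 1)) (Complex R 1)"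
        using t R1 by (simp add: in_box_complex_iff)
    qed
    ultimately have "((\<lambda>z. \<phi> z / (z - of_real (t + real j))) has_contour_integral
        (2 * of_real pi * \<i> * \<phi> (of_real (t + real j)))) ?\<gamma>" if "j \<le> K" for j
      using that by fastforce
    then have "((\<lambda>z. \<Sum>j\<le>K. (- ((-1) ^ j * of_nat (K choose j))) * (\<phi> z / (z - of_real (t + real j))))
        has_contour_integral (\<Sum>j\<le>K. (- ((-1) ^ j * of_nat (K choose j))) * (2 * of_real pi * \<i> * \<phi> (of_real (t + real j))))) ?\<gamma>"
      by (intro has_contour_integral_sum has_contour_integral_lmul) auto
    moreover have "(\<Sum>j\<le>K. (- ((-1) ^ j * of_nat (K choose j))) * (\<phi> z / (z - of_real (t + real j)))) = ?F z" for z
    proof -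
      have "- c * (u / (z - of_real (t + real j))) = u * (c / (of_real t - z + of_nat j))" for c u j
      proof -
        have "of_real t - z + of_nat j = - (z - of_real (t + real j))" by simp
        then show ?thesis by (simp only: minus_divide_right[symmetric] divide_minus_right) simp
      qed
      then show ?thesis by (simp only: complete_beta_def sum_distrib_left)
    qed
    moreover have "(\<Sum>j\<le>K. (- ((-1) ^ j * of_nat (K choose j))) * (2 * of_real pi * \<i> * \<phi> (of_real (t + real j))))
        = - (2 * of_real pi * \<i> * S)"
      unfolding S_def sum_distrib_left sum_negf[symmetric] by (intro sum.cong refl) (simp add: mult_ac)
    ultimately have "(?F has_contour_integral - (2 * of_real pi * \<i> * S)) ?\<gamma>" by simp
    then have "contour_integral ?\<gamma> ?F = - (2 * of_real pi * \<i> * S)" by (rule contour_integral_unique)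
    with contour_integral_rectpath_edges[OF cont[OF pim(2)]] show ?thesis by simp
  qed
  have seg: "closed_segment (Complex (- R) v) (Complex R v) \<subseteq> Q" "Complex 0 v \<in> closed_segment (Complex (- R) v) (Complex R v)"
    if "\<bar>v\<bar> = 1" for v
    using that R1 by (auto simp: Q_def closed_segment_same_Im closed_segment_eq_real_ivl dest!: horizontal_segmentD)
  have splt: "?ci (Complex (- R) v) (Complex R v) = ?ci (Complex (- R) v) (Complex 0 v) + ?ci (Complex 0 v) (Complex R v)"
    if "\<bar>v\<bar> = 1" for v
    by (intro contour_integral_split_linepath cont seg that)
  have rev: "?ci b a = - ?ci a b" for a b
    by (metis contour_integral_reversepath reversepath_linepath valid_path_linepath)
  have "contour_integral (left_loop R) ?F = ?ci (Complex (- R) (- 1)) (Complex 0 (- 1))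
      + ?ci (Complex 0 (- 1)) (Complex 0 1) + ?ci (Complex 0 1) (Complex (- R) 1)"
    using R1 by (intro contour_integral_left_loop(2) continuous_times_beta(1) t) auto
  note ends = this
  have loop: "contour_integral (left_loop R) ?F - 2 * of_real pi * \<i> * S
      = ?ci (Complex (- R) (- R)) (Complex R (- R)) + ?ci (Complex R (- R)) (Complex R (- 1))
        + ?ci (Complex (- R) (- 1)) (Complex (- R) (- R)) + ?ci (Complex R (- 1)) (Complex R 1)
        + ?ci (Complex R 1) (Complex R R) + ?ci (Complex R R) (Complex (- R) R)
        + ?ci (Complex (- R) R) (Complex (- R) 1)"
  proof -
    have "l - W = b1 + b2 + a1 + fe + et + tt + td"
      if "l = ab + bc + cd" "dc + ce + et + tt + td = 0" "b1 + b2 + fa + a1 = 0"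
        "bf + fe + ec + cb = - W" "fa = - (ab + bf)" "dc = - cd" "ec = - ce" "cb = - bc"
      for l W ab bc cd dc ce et tt td b1 b2 fa a1 bf fe ec cb :: complex
      using that by algebra
    note combine = this
    have bottom: "?ci (Complex R (- 1)) (Complex (- R) (- 1))
        = - (?ci (Complex (- R) (- 1)) (Complex 0 (- 1)) + ?ci (Complex 0 (- 1)) (Complex R (- 1)))"
      by (subst rev) (simp add: splt[of "- 1"])
    have upper: "?ci (Complex (- R) 1) (Complex 0 1) + ?ci (Complex 0 1) (Complex R 1) + ?ci (Complex R 1) (Complex R R)
        + ?ci (Complex R R) (Complex (- R) R) + ?ci (Complex (- R) R) (Complex (- R) 1) = 0"
      using top by (simp add: splt[of 1])
    show ?thesis
      by (rule combine[OF ends upper bot mid bottom rev rev rev])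
  qed
  \<comment> \<open>On the sides of the square every pole is at distance at least R - t - K.\<close>
  have edge: "norm (?F z) \<le> ?E"
    if "Re z \<ge> 0 \<or> \<bar>Im z\<bar> \<ge> 1" "\<bar>Re z\<bar> = R \<or> \<bar>Im z\<bar> = R" "\<bar>Re z\<bar> \<le> R" "\<bar>Im z\<bar> \<le> R" for z
  proof -
    have n: "norm z \<ge> R" "norm z \<le> 2 * R"
      using that abs_Re_le_cmod[of z] abs_Im_le_cmod[of z] cmod_le[of z] by linarith+
    have far: "R - t - real K \<le> norm (of_real t - z + of_nat j)" if "j \<le> K" for j
    proof -
      have "norm z = norm (of_real (t + real j) - (of_real t - z + of_nat j))" by simp
      also have "\<dots> \<le> norm (complex_of_real (t + real j)) + norm (of_real t - z + of_nat j)"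
        by (rule norm_triangle_ineq4)
      also have "norm (complex_of_real (t + real j)) = t + real j" using t by (simp only: norm_of_real)
      finally show ?thesis using n that by simp
    qed
    have "of_real t - z + of_nat j \<noteq> 0" if "j \<le> K" for j
      using far[OF that] R1 by (auto simp del: of_nat_add)
    then have "complete_beta (of_real t - z) = fact K / pochhammer (of_real t - z) (Suc K)"
      unfolding complete_beta_def by (rule sum_binomial_partial_fractions)
    moreover have "norm (pochhammer (of_real t - z) (Suc K)) \<ge> (R - t - real K) ^ Suc K"
    proof -
      have "(R - t - real K) ^ Suc K = (\<Prod>j<Suc K. R - t - real K)" by simp
      also have "\<dots> \<le> (\<Prod>j<Suc K. norm (of_real t - z + of_nat j))"
        using R1 by (intro prod_mono conjI far) auto
      finally show ?thesis by (simp add: pochhammer_prod lessThan_atLeast0 prod_norm del: prod.lessThan_Suc prod.op_ivl_Suc)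
    qed
    ultimately have "norm (complete_beta (of_real t - z)) \<le> fact K / (R - t - real K) ^ Suc K"
      using R1 by (simp add: norm_divide frac_le)
    moreover have "norm (\<phi> z) \<le> C * (1 + 2 * R) ^ P"
      using n C_nonneg that(1) by (intro order_trans[OF growth] mult_left_mono power_mono) auto
    ultimately show ?thesis
      unfolding norm_mult using C_nonneg R1 by (intro mult_mono) auto
  qed
  have horiz: "norm (?ci (Complex x v) (Complex x' v)) \<le> ?E * (2 * R)"
    if "\<bar>v\<bar> = R" "\<bar>x\<bar> = R" "\<bar>x'\<bar> = R" for x x' v
  proof -
    have "norm (?ci (Complex x v) (Complex x' v)) \<le> ?E * norm (Complex x' v - Complex x v)"
    proof (rule contour_integral_bound_linepath)
      show "?F contour_integrable_on linepath (Complex x v) (Complex x' v)"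
        by (intro contour_integrable_continuous_linepath cont)
           (use that R1 in \<open>auto simp: Q_def dest!: horizontal_segmentD\<close>)
      fix z assume "z \<in> closed_segment (Complex x v) (Complex x' v)"
      then show "norm (?F z) \<le> ?E"
        using horizontal_segmentD[of z x v x'] that R1
        by (intro edge) (auto simp: min_def max_def abs_le_iff split: if_splits)
    qed (rule E)
    also have "\<dots> \<le> ?E * (2 * R)"
      using that by (intro mult_left_mono E) (simp add: complex_diff norm_complex_def)
    finally show ?thesis .
  qed
  have vert: "norm (?ci (Complex x v) (Complex x v')) \<le> ?E * \<bar>v' - v\<bar>"
    if "x = R \<or> x = - R \<and> (v \<ge> 1 \<and> v' \<ge> 1 \<or> v \<le> - 1 \<and> v' \<le> - 1)" "\<bar>v\<bar> \<le> R" "\<bar>v'\<bar> \<le> R" for x v v'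
  proof -
    have "norm (?ci (Complex x v) (Complex x v')) \<le> ?E * norm (Complex x v' - Complex x v)"
    proof (rule contour_integral_bound_linepath)
      show "?F contour_integrable_on linepath (Complex x v) (Complex x v')"
        by (intro contour_integrable_continuous_linepath cont)
           (use that R1 d_pos in \<open>auto simp: Q_def dest!: vertical_segmentD\<close>)
      fix z assume "z \<in> closed_segment (Complex x v) (Complex x v')"
      then show "norm (?F z) \<le> ?E"
        using vertical_segmentD[of z x v v'] that R1
        by (intro edge) (auto simp: min_def max_def abs_le_iff split: if_splits)
    qed (rule E)
    then show ?thesis by (simp add: complex_diff norm_complex_def)
  qed
  have tri: "norm (u1 + u2 + u3 + u4 + u5 + u6 + u7) \<le> norm u1 + norm u2 + norm u3 + norm u4 + norm u5 + norm u6 + norm u7"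
    for u1 u2 u3 u4 u5 u6 u7 :: complex
    by (intro order_trans[OF norm_triangle_ineq] add_mono order_refl)
  have "norm (contour_integral (left_loop R) ?F - 2 * of_real pi * \<i> * S)
      \<le> ?E * (2 * R) + ?E * \<bar>- 1 - - R\<bar> + ?E * \<bar>- R - - 1\<bar> + ?E * \<bar>1 - - 1\<bar> + ?E * \<bar>R - 1\<bar>
        + ?E * (2 * R) + ?E * \<bar>1 - R\<bar>"
    unfolding loop using R1 by (intro order_trans[OF tri] add_mono horiz vert) auto
  also have "\<dots> = ?E * (8 * R - 2)" using R1 by (simp only: distrib_left[symmetric]) simp
  also have "\<dots> \<le> ?E * (8 * R)" using E by (intro mult_left_mono) auto
  finally show ?thesis unfolding S_def by (simp only: mult_ac)
qed

text \<open>Differences of order \<open>K\<close> of the kernel are integrals of the density against the nonnegative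
  weight \<open>s powr (t - 1) * (1 - s) ^ K\<close>.\<close>

lemma Re_difference_nonneg:
  assumes nonneg: "\<And>s. 0 < s \<Longrightarrow> s < 1 \<Longrightarrow> loop_density s \<in> \<real>\<^sub>\<ge>\<^sub>0" and t: "t > 0"
  shows "0 \<le> Re (\<Sum>j\<le>K. (-1) ^ j * of_nat (K choose j) * \<phi> (of_real (t + real j)))"
proof -
  define S where "S = (\<Sum>j\<le>K. (-1) ^ j * of_nat (K choose j) * \<phi> (of_real (t + real j)))"
  define B where "B = 8 * C * 3 ^ P * fact K * 2 ^ Suc K"
  have B: "B \<ge> 0" using C_nonneg by (simp add: B_def)
  \<comment> \<open>The length 8 R times the growth R ^ P times the decay R ^ (- K - 1) is of order 1 / R or better.\<close>
  have low: "Re S \<ge> - (slack / t + B) / R" if R: "R \<ge> 2 * (t + real K) + 1" for R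
  proof -
    let ?c = "1 / (2 * of_real pi * \<i>) :: complex"
    let ?X = "contour_integral (left_loop R) (\<lambda>z. \<phi> z * complete_beta (of_real t - z))"
    have R1: "R \<ge> 1" "R - t - real K \<ge> R / 2" using R t by auto
    have "norm (?X - 2 * of_real pi * \<i> * S) \<le> 8 * R * (C * (1 + 2 * R) ^ P * (fact K / (R - t - real K) ^ Suc K))"
      unfolding S_def by (rule loop_residues[OF t R])
    also have "\<dots> \<le> 8 * R * (C * (3 * R) ^ P * (fact K / (R / 2) ^ Suc K))"
    proof -
      have "(R / 2) ^ Suc K \<le> (R - t - real K) ^ Suc K" using R1 by (intro power_mono) auto
      then show ?thesis
        using R1 C_nonneg by (intro mult_left_mono mult_mono power_mono divide_left_mono mult_pos_pos zero_less_power) auto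
    qed
    also have "\<dots> = B * (R ^ Suc P / R ^ Suc K)"
      using R1 by (simp add: B_def power_mult_distrib power_divide field_simps)
    also have "\<dots> \<le> B * (R ^ Suc P / R ^ Suc (Suc P))"
      using R1 B K_large by (intro mult_left_mono divide_left_mono power_increasing) auto
    also have "\<dots> = B / R" using R1 by simp
    finally have err: "norm (?X - 2 * of_real pi * \<i> * S) \<le> B / R" .
    have "S = ?c * ?X - ?c * (?X - 2 * of_real pi * \<i> * S)" by (simp add: right_diff_distrib)
    then have "Re S = Re (?c * ?X) - Re (?c * (?X - 2 * of_real pi * \<i> * S))"
      by (metis minus_complex.sel(1))
    moreover have "Re (?c * (?X - 2 * of_real pi * \<i> * S)) \<le> norm ?c * norm (?X - 2 * of_real pi * \<i> * S)"
      by (rule order_trans[OF complex_Re_le_cmod norm_mult_ineq])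
    moreover have "norm ?c * norm (?X - 2 * of_real pi * \<i> * S) \<le> 1 * norm (?X - 2 * of_real pi * \<i> * S)"
      using pi_gt3 by (intro mult_right_mono) (auto simp: norm_divide norm_mult divide_le_eq)
    moreover have "Re (?c * ?X) \<ge> - (slack / (R * t))"
      by (rule Re_loop_complete_beta_lower_bound[OF nonneg R1(1) t])
    moreover have "- (slack / t + B) / R = - (slack / (R * t)) - B / R"
      by (simp add: diff_divide_distrib mult.commute)
    ultimately show ?thesis using err by linarith
  qed
  have "0 \<le> Re S"
  proof (rule tendsto_upperbound)
    show "((\<lambda>R. - (slack / t + B) / R) \<longlongrightarrow> 0) at_top" by real_asymp
    show "\<forall>\<^sub>F R in at_top. - (slack / t + B) / R \<le> Re S"
      using eventually_ge_at_top[of "2 * (t + real K) + 1"] by eventually_elim (rule low)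
  qed simp
  then show ?thesis by (simp add: S_def)
qed

end

section \<open>Complete monotonicity from a nonnegative Meijer density\<close>

text \<open>The threshold \<open>J\<close> comes from the growth exponent of the Gamma quotient. The argument \<open>t\<close> stays positive
  because the loop passes through the origin, which the residue at \<open>t\<close> must keep clear of.\<close>

lemma meijer_G_nonneg_difference:
  fixes a b :: "nat \<Rightarrow> real"
  assumes a: "\<And>i. i \<in> {1..q::nat} \<Longrightarrow> a i > 0" and b: "\<And>i. i \<in> {1..q} \<Longrightarrow> b i > 0"
    and nonneg: "\<And>s. s \<in> {0<..<1} \<Longrightarrow> meijer_G q a b s \<in> \<real>\<^sub>\<ge>\<^sub>0"
  obtains J where "\<And>K t. K \<ge> J \<Longrightarrow> t > 0 \<Longrightarrow>
    0 \<le> (\<Sum>j\<le>K. (-1) ^ j * real (K choose j)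
          * ((\<Prod>i=1..q. Gamma (a i + (t + real j))) / (\<Prod>i=1..q. Gamma (b i + (t + real j)))))"
proof -
  define \<phi> where "\<phi> z = (\<Prod>i=1..q. Gamma (of_real (a i) + z)) / (\<Prod>i=1..q. Gamma (of_real (b i) + z))" for z :: complex
  have "polynomial_growth {z. Re z \<ge> 0 \<or> \<bar>Im z\<bar> \<ge> 1} \<phi>"
    unfolding \<phi>_def[abs_def] by (rule polynomial_growth_Gamma_quotient[OF a b])
  then obtain C P where C: "C \<ge> 0"
    and "\<forall>z\<in>{z. Re z \<ge> 0 \<or> \<bar>Im z\<bar> \<ge> 1}. norm (\<phi> z) \<le> C * (1 + norm z) ^ P"
    unfolding polynomial_growth_def by blast
  then have growth: "norm (\<phi> z) \<le> C * (1 + norm z) ^ P" if "Re z \<ge> 0 \<or> \<bar>Im z\<bar> \<ge> 1" for z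
    using that by blast
  \<comment> \<open>The Gamma quotient is regular off the real half line to the left of - d.\<close>
  obtain d where d: "d > 0" "\<And>i. i \<in> {1..q} \<Longrightarrow> d \<le> a i" "\<And>i. i \<in> {1..q} \<Longrightarrow> d \<le> b i"
  proof
    let ?A = "insert 1 (a ` {1..q} \<union> b ` {1..q})"
    show "Min ?A > 0" using a b by (subst Min_gr_iff) auto
    show "Min ?A \<le> a i" "Min ?A \<le> b i" if "i \<in> {1..q}" for i
      using that by (intro Min_le; auto)+
  qed
  have hol: "\<phi> holomorphic_on {z. Im z \<noteq> 0 \<or> Re z > - d}"
  proof -
    have ni: "of_real (a i) + z \<notin> \<int>\<^sub>\<le>\<^sub>0" "of_real (b i) + z \<notin> \<int>\<^sub>\<le>\<^sub>0"
      if "i \<in> {1..q}" "z \<in> {z. Im z \<noteq> 0 \<or> Re z > - d}" for i z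
      using d(2,3)[OF that(1)] that(2) by (intro of_real_plus_not_nonpos_Ints; force)+
    show ?thesis
      unfolding \<phi>_def using ni
      by (intro holomorphic_intros holomorphic_Gamma') (auto simp: Gamma_eq_zero_iff)
  qed
  have real: "\<phi> (of_real x) = of_real ((\<Prod>i=1..q. Gamma (a i + x)) / (\<Prod>i=1..q. Gamma (b i + x)))" for x
    by (simp add: \<phi>_def flip: Gamma_complex_of_real)
  show ?thesis
  proof (rule that)
    fix K t assume K: "K \<ge> P + 2" and t: "(t::real) > 0"
    interpret left_loop_kernel \<phi> d C P K
      by unfold_locales (use d(1) hol C growth K in auto)
    have "loop_density s = meijer_G q a b s" for s
      by (simp add: loop_density_def meijer_G_def truncated_def \<phi>_def)
    then have "0 \<le> Re (\<Sum>j\<le>K. (-1) ^ j * of_nat (K choose j) * \<phi> (of_real (t + real j)))"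
      by (intro Re_difference_nonneg t) (simp add: nonneg)
    also have "(\<Sum>j\<le>K. (-1) ^ j * of_nat (K choose j) * \<phi> (of_real (t + real j)))
       = of_real (\<Sum>j\<le>K. (-1) ^ j * real (K choose j)
          * ((\<Prod>i=1..q. Gamma (a i + (t + real j))) / (\<Prod>i=1..q. Gamma (b i + (t + real j)))))"
      unfolding real by simp
    finally show "0 \<le> (\<Sum>j\<le>K. (-1) ^ j * real (K choose j)
          * ((\<Prod>i=1..q. Gamma (a i + (t + real j))) / (\<Prod>i=1..q. Gamma (b i + (t + real j)))))"
      by (simp only: Re_complex_of_real)
  qed
qed

text \<open>The sequence is \<open>\<Phi> n / \<Phi> 0\<close> for the Gamma quotient \<open>\<Phi>\<close>. Its difference at \<open>n\<close> is the limit of the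
  differences at \<open>n + t\<close> as \<open>t\<close> decreases to 0, which reaches the index \<open>n = 0\<close> as well.\<close>

lemma completely_monotone_of_meijer_G_nonneg:
  fixes a b :: "nat \<Rightarrow> real"
  assumes a: "\<And>i. i \<in> {1..q::nat} \<Longrightarrow> a i > 0" and b: "\<And>i. i \<in> {1..q} \<Longrightarrow> b i > 0"
    and le: "(\<Sum>i=1..q. a i) \<le> (\<Sum>i=1..q. b i)"
    and nonneg: "\<And>s. s \<in> {0<..<1} \<Longrightarrow> meijer_G q a b s \<in> \<real>\<^sub>\<ge>\<^sub>0"
  shows "completely_monotone (\<lambda>n. (\<Prod>i=1..q. pochhammer (a i) n) / (\<Prod>i=1..q. pochhammer (b i) n))"
proof -
  let ?m = "\<lambda>n. (\<Prod>i=1..q. pochhammer (a i) n) / (\<Prod>i=1..q. pochhammer (b i) n)"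
  define \<Phi> where "\<Phi> x = (\<Prod>i=1..q. Gamma (a i + x)) / (\<Prod>i=1..q. Gamma (b i + x))" for x :: real
  obtain J where J: "\<And>K t. K \<ge> J \<Longrightarrow> t > 0 \<Longrightarrow> 0 \<le> (\<Sum>j\<le>K. (-1) ^ j * real (K choose j) * \<Phi> (t + real j))"
    using meijer_G_nonneg_difference[of q a b] a b nonneg unfolding \<Phi>_def by blast
  have pos: "(\<Prod>i=1..q. Gamma (c i + x)) > 0" if "\<And>i. i \<in> {1..q} \<Longrightarrow> c i > 0" "x \<ge> 0" for c :: "nat \<Rightarrow> real" and x
    using that by (intro prod_pos Gamma_real_pos ballI) (auto intro: add_pos_nonneg)
  have \<Phi>0: "\<Phi> 0 > 0" unfolding \<Phi>_def using a b by (intro divide_pos_pos pos) auto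
  have cont: "isCont \<Phi> (real n)" for n
  proof -
    have "c + real n \<notin> \<int>\<^sub>\<le>\<^sub>0" if "c > 0" for c :: real
      using that by (metis add_pos_nonneg nonpos_Ints_nonpos not_le of_nat_0_le_iff)
    then show ?thesis
      unfolding \<Phi>_def using a b pos[of b "real n"]
      by (intro continuous_intros isCont_Gamma) (auto simp del: prod_zero_iff)
  qed
  have m\<Phi>: "?m n = \<Phi> (real n) / \<Phi> 0" for n
  proof -
    have p: "(\<Prod>i=1..q. pochhammer (c i) n) = (\<Prod>i=1..q. Gamma (c i + real n)) / (\<Prod>i=1..q. Gamma (c i + 0))"
      if "\<And>i. i \<in> {1..q} \<Longrightarrow> c i > 0" for c :: "nat \<Rightarrow> real"
      unfolding prod_dividef[symmetric]
    proof (intro prod.cong refl)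
      fix i assume "i \<in> {1..q}"
      then have "c i \<notin> \<int>\<^sub>\<le>\<^sub>0" using that[of i] by (metis nonpos_Ints_nonpos not_le)
      then show "pochhammer (c i) n = Gamma (c i + real n) / Gamma (c i + 0)" by (simp add: pochhammer_Gamma)
    qed
    have "(\<Prod>i=1..q. pochhammer (a i) n) = (\<Prod>i=1..q. Gamma (a i + real n)) / (\<Prod>i=1..q. Gamma (a i + 0))"
      "(\<Prod>i=1..q. pochhammer (b i) n) = (\<Prod>i=1..q. Gamma (b i + real n)) / (\<Prod>i=1..q. Gamma (b i + 0))"
      by (rule p, use a b in simp)+
    then show ?thesis by (simp only: \<Phi>_def) (simp add: field_simps)
  qed
  have high: "0 \<le> (backward_diff ^^ K) ?m n" if K: "K \<ge> J" for K n
  proof -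
    let ?g = "\<lambda>t. \<Sum>j\<le>K. (-1) ^ j * real (K choose j) * \<Phi> (real n + t + real j)"
    have "isCont ?g 0"
    proof (intro continuous_intros)
      fix j
      show "isCont (\<lambda>t. \<Phi> (real n + t + real j)) 0"
        by (rule isCont_o2[where g = \<Phi>]) (use cont[of "n + j"] in \<open>auto intro!: continuous_intros\<close>)
    qed
    then have "(?g \<longlongrightarrow> ?g 0) (at_right 0)"
      by (simp add: isCont_def filterlim_at_split)
    moreover have "\<forall>\<^sub>F t in at_right (0::real). 0 \<le> ?g t"
    proof -
      have "\<forall>\<^sub>F t in at_right (0::real). t > 0" by (rule eventually_at_right_less)
      then show ?thesis
      proof eventually_elim
        case (elim t)
        then show ?case by (intro J[OF K]) simp
      qed
    qed
    ultimately have "0 \<le> ?g 0"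
      by (intro tendsto_lowerbound[of ?g _ "at_right 0"]) simp_all
    moreover have "(backward_diff ^^ K) ?m n = ?g 0 / \<Phi> 0"
      unfolding backward_diff_pow_binomial m\<Phi> by (simp add: sum_divide_distrib)
    ultimately show ?thesis using \<Phi>0 by simp
  qed
  obtain B where "\<And>n. \<bar>?m n\<bar> \<le> B"
    using bounded_pochhammer_quotient[of q a b] a b le by blast
  moreover have "0 \<le> ?m n" for n
    using a b by (intro divide_nonneg_nonneg prod_nonneg ballI pochhammer_nonneg) auto
  ultimately show ?thesis
    using high by (intro completely_monotone_of_high_differences) auto
qed

section \<open>Bounds for the hypergeometric function\<close>

lemma prod_shift_eq_extend:
  fixes a b :: "nat \<Rightarrow> real"
  assumes "\<And>n. n \<ge> 1 \<Longrightarrow> (\<Prod>i=1..q. a i + real n) = (\<Prod>i=1..q. b i + real n)"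
  shows "(\<Prod>i=1..q. a i) = (\<Prod>i=1..q. b i)"
proof -
  define p where "p = (\<Prod>i=1..q. [:a i, 1:]) - (\<Prod>i=1..q. [:b i, 1:])"
  have p: "poly p x = (\<Prod>i=1..q. a i + x) - (\<Prod>i=1..q. b i + x)" for x
    by (simp add: p_def poly_prod)
  have "real ` {1..} \<subseteq> {x. poly p x = 0}" using assms by (auto simp: p)
  moreover have "infinite (real ` {1..})"
    by (simp add: finite_image_iff infinite_Ici)
  ultimately have "infinite {x. poly p x = 0}" using infinite_super by blast
  then have "p = 0" using poly_roots_finite by blast
  then show ?thesis using p[of 0] by simp
qed

theorem proposition3p3:
  fixes q :: nat and a b :: "nat \<Rightarrow> real" and \<mu> \<sigma> x :: real
  assumes "q \<ge> 1"
    and "\<And>i. i \<in> {1..q} \<Longrightarrow> a i > 0"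
    and "\<And>i. i \<in> {1..q} \<Longrightarrow> b i > 0"
    and "\<mu> = (\<Prod>i=1..q. a i / b i)"
    and "0 < \<mu>" and "\<mu> < 1"
    and "(\<forall>k\<in>{1..q}. b k > a k) \<or>
         ((\<Sum>i=1..q. a i) \<le> (\<Sum>i=1..q. b i) \<and>
          (\<forall>s\<in>{0<..<1}. meijer_G q a b s \<in> \<real>\<^sub>\<ge>\<^sub>0))"
    and "\<sigma> > 0"
    and "x \<noteq> 0" and "x > -1"
  shows "hyp_F q \<sigma> a b (of_real (- x)) \<in> \<real> \<and>
         (1 + x * \<mu>) powr (- \<sigma>) < Re (hyp_F q \<sigma> a b (of_real (- x))) \<and>
         Re (hyp_F q \<sigma> a b (of_real (- x))) < (1 - \<mu>) + \<mu> * (1 + x) powr (- \<sigma>)"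
proof -
  define m where "m n = (\<Prod>i=1..q. pochhammer (a i) n) / (\<Prod>i=1..q. pochhammer (b i) n)" for n
  define r where "r n = (\<Prod>i=1..q. (a i + real n) / (b i + real n))" for n
  have a: "\<And>i. i \<in> {1..q} \<Longrightarrow> a i > 0" and b: "\<And>i. i \<in> {1..q} \<Longrightarrow> b i > 0" by fact+
  have m0: "m 0 = 1" by (simp add: m_def)
  have m1: "m 1 = \<mu>" using assms(4) by (simp add: m_def prod_dividef)
  have Suc: "m (Suc n) = r n * m n" for n
    unfolding m_def r_def by (rule pochhammer_quotient_Suc)
  have mpos: "m n > 0" for n
    unfolding m_def using a b by (intro divide_pos_pos prod_pos ballI pochhammer_pos) auto
  have r1: "r \<longlonglongrightarrow> 1"
    unfolding r_def by (rule pochhammer_quotient_ratio_tendsto)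
  have cm: "completely_monotone m"
    using assms(7)
  proof
    assume "\<forall>k\<in>{1..q}. b k > a k"
    then have "completely_monotone (\<lambda>n. \<Prod>i=1..q. pochhammer (a i) n / pochhammer (b i) n)"
      using a by (intro completely_monotone_prod completely_monotone_pochhammer_ratio) auto
    then show ?thesis by (simp add: m_def[abs_def] prod_dividef)
  next
    assume "(\<Sum>i=1..q. a i) \<le> (\<Sum>i=1..q. b i) \<and> (\<forall>s\<in>{0<..<1}. meijer_G q a b s \<in> \<real>\<^sub>\<ge>\<^sub>0)"
    then show ?thesis
      unfolding m_def[abs_def] using a b by (intro completely_monotone_of_meijer_G_nonneg) auto
  qed
  have var: "m 2 \<noteq> (m 1)\<^sup>2"
  proof
    assume "m 2 = (m 1)\<^sup>2"
    then have "r n * m n = \<mu> * m n" for n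
      using completely_monotone_variance(2)[OF cm m0, of n] unfolding m1 Suc by blast
    then have "r n = \<mu>" for n using mpos[of n] by (metis less_irrefl mult_right_cancel)
    then have "r = (\<lambda>_. \<mu>)" by (rule ext)
    then have "\<mu> = 1" using r1 by (simp add: LIMSEQ_const_iff)
    then show False using assms(6) by simp
  qed
  have bern: "m 2 \<noteq> m 1"
  proof
    assume eq: "m 2 = m 1"
    have "(\<Prod>i=1..q. a i + real n) = (\<Prod>i=1..q. b i + real n)" if "n \<ge> 1" for n
    proof -
      have "m n = m 1" "m (Suc n) = m 1"
        by (rule completely_monotone_equal_moments[OF cm eq], use that in simp)+
      then have "m 1 = r n * m 1" using Suc[of n] by metis
      then have "r n = 1" using mpos[of 1] by (metis less_irrefl mult_cancel_right1)
      moreover have "(\<Prod>i=1..q. b i + real n) > 0" using b by (intro prod_pos) (auto intro: add_pos_nonneg)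
      ultimately show ?thesis by (simp add: r_def prod_dividef)
    qed
    then have "(\<Prod>i=1..q. a i) = (\<Prod>i=1..q. b i)" by (rule prod_shift_eq_extend)
    moreover have "(\<Prod>i=1..q. b i) > 0" using b by (intro prod_pos) auto
    ultimately have "\<mu> = 1" unfolding assms(4) prod_dividef by (metis divide_self less_irrefl)
    then show False using assms(6) by simp
  qed
  show ?thesis
    using hyp_F_bounds[OF cm assms(8) m_def var bern assms(10,9)] by (simp only: m1)
qed

end
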